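(* Let $\mathcal T_{k,\beta}^\Gamma(t)$, $t\in\mathbb R/2\pi\mathbb Z$, be the weighted symbol on $\mathcal H_\Gamma$, let $\mathcal T_{\mathrm{ref}}^\Gamma\in\mathcal L(\mathcal H_\Gamma)$ be a $t$-independent reference operator, $\mathscr C$ a contour with reference Riesz projection $\Pi^{\mathrm{ref}}$, and $E=\operatorname{Ran}\Pi^{\mathrm{ref}}$, $1\le\dim E<\infty$, all as in the context. Set $$\varepsilon:=\sup_{0\le t\le2\pi}\|\mathcal T_{k,\beta}^\Gamma(t)-\mathcal T_{\mathrm{ref}}^\Gamma\|_{\mathcal L(\mathcal H_\Gamma)}.$$ There exist $\varepsilon_0>0$ and $C<\infty$, depending only on $\mathcal T_{\mathrm{ref}}^\Gamma$, $\Pi^{\mathrm{ref}}$, and $\mathscr C$, such that, if $\varepsilon\le\varepsilon_0$, then for every $t$ the contour $\mathscr C$ lies in the resolvent set of $\mathcal T_{k,\beta}^\Gamma(t)$ and encloses a spectral cluster whose Riesz projection $\Pi^\Gamma(t)$ has rank $\dim E$, the map $U_E^\Gamma(t)=\Pi^\Gamma(t)|_E:E\to\operatorname{Ran}\Pi^\Gamma(t)$ is an isomorphism, and $$\sup_t\left(\|\Pi^\Gamma(t)-\Pi^{\mathrm{ref}}\|+\|U_E^\Gamma(t)-\iota_E\|+\|V_E^\Gamma(t)-(\Pi^{\mathrm{ref}})^\dagger\iota_E\|\right)\le C\varepsilon .$$ Moreover, $$\sup_t\left\|M_E^\Gamma(t)-\Pi^{\mathrm{ref}}\mathcal T_{k,\beta}^\Gamma(t)|_E\right\|_{\mathcal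 L(E)}\le C\varepsilon^2 .$$ If $\nu\in\mathbb C$ and $r,\ell\in E$ satisfy $$M_E^\Gamma(t)r=\nu r,\qquad \bigl(M_E^\Gamma(t)\bigr)^\dagger\ell=\overline\nu\,\ell,\qquad \ell^\dagger r=1,$$ then $U_E^\Gamma(t)r$ and $V_E^\Gamma(t)\ell$ are exact right and left eigenvectors of $\mathcal T_{k,\beta}^\Gamma(t)$ (that is, $\mathcal T_{k,\beta}^\Gamma(t)U_E^\Gamma(t)r=\nu U_E^\Gamma(t)r$ and $\mathcal T_{k,\beta}^\Gamma(t)^\dagger V_E^\Gamma(t)\ell=\overline\nu V_E^\Gamma(t)\ell$), are biorthogonally normalized, i.e. $(V_E^\Gamma(t)\ell)^\dagger U_E^\Gamma(t)r=1$, and satisfy $$\|(U_E^\Gamma(t)-\iota_E)r\|\le C\varepsilon\|r\|,\qquad \|\bigl(V_E^\Gamma(t)-(\Pi^{\mathrm{ref}})^\dagger\iota_E\bigr)\ell\|\le C\varepsilon\|\ell\|.$$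
   Context: Fix $k>0$, $\eta>0$, $\lambda>1$, $\beta\in(-1,0)$. $\Gamma\subset\mathbb R^3$ is a smooth compact boundary (finite disjoint union of closed $C^\infty$ surfaces, outward unit normal $\nu$) with $\Gamma\subset\{r_-\le|x|\le r_+\}$, $0<r_-<r_+<\lambda r_-$. $\mathcal H_\Gamma$ is the Hilbert space of $\varphi\in L^2(\Gamma)$ with $\|\varphi\|_{\mathcal H_\Gamma}:=\|(k^2-\Delta_\Gamma)^{1/4}\varphi\|_{L^2(\Gamma)}<\infty$, $-\Delta_\Gamma\ge0$ the Laplace-Beltrami operator. With $G_k(x,y)=\frac{e^{ik|x-y|}}{4\pi|x-y|}$ and $\mathsf K_\eta^k(x,z)=\partial_{\nu_x}G_k(x,z)-i\eta kG_k(x,z)$, define on $\mathcal H_\Gamma$: $B_0^{k,\Gamma}:=\frac12I+(K_k^\Gamma)^\ast-i\eta kS_k^\Gamma$, where $(S_k^\Gamma\mu)(x)=\int_\Gamma G_k(x,y)\mu(y)d\sigma(y)$, $((K_k^\Gamma)^\ast\mu)(x)=\mathrm{p.v.}\int_\Gamma\partial_{\nu_x}G_k(x,y)\mu(y)d\sigma(y)$, and for $n\neq0$, $(B_n^{k,\Gamma}\varphi)(x):=\lambda^n\int_\Gamma\mathsf K_\eta^k(x,\lambda^ny)\varphi(y)d\sigma(y)$. The weighted symbol is $\mathcal T_{k,\beta}^\Gamma(t):=\sum_{n\in\mathbb Z}e^{-int}\lambda^{\beta n}B_n^{k,\Gamma}$; the series converges absolutely in operator norm, uniformly in $t$, and defines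 a $C^1$ loop in $\mathcal L(\mathcal H_\Gamma)$. $\mathcal T_{\mathrm{ref}}^\Gamma\in\mathcal L(\mathcal H_\Gamma)$ is bounded, and $\mathscr C$ is a positively oriented contour in its resolvent set enclosing an isolated spectral cluster such that $\Pi^{\mathrm{ref}}:=\frac1{2\pi i}\int_{\mathscr C}(\zeta I-\mathcal T_{\mathrm{ref}}^\Gamma)^{-1}d\zeta$ has finite rank; $E:=\operatorname{Ran}\Pi^{\mathrm{ref}}$, $1\le\dim E<\infty$, with the inner product of $\mathcal H_\Gamma$; $\iota_E:E\hookrightarrow\mathcal H_\Gamma$ is the inclusion. $\Pi^{\mathrm{ref}}$ need not be orthogonal. Whenever $\mathscr C$ lies in the resolvent set of $\mathcal T_{k,\beta}^\Gamma(t)$: $\Pi^\Gamma(t):=\frac1{2\pi i}\int_{\mathscr C}(\zeta I-\mathcal T_{k,\beta}^\Gamma(t))^{-1}d\zeta$ and $U_E^\Gamma(t):=\Pi^\Gamma(t)|_E:E\to\operatorname{Ran}\Pi^\Gamma(t)$. Whenever $U_E^\Gamma(t)$ is an isomorphism: $M_E^\Gamma(t):=(U_E^\Gamma(t))^{-1}\mathcal T_{k,\beta}^\Gamma(t)|_{\operatorname{Ran}\Pi^\Gamma(t)}U_E^\Gamma(t)\in\mathcal L(E)$, and $V_E^\Gamma(t):E\to\mathcal H_\Gamma$ is defined by $(V_E^\Gamma(t))^\dagger:=(U_E^\Gamma(t))^{-1}\Pi^\Gamma(t):\mathcal H_\Gamma\to E$. Here ${}^\dagger$ denotes Hilbert adjoints,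 and $\ell^\dagger r$ is the inner product, conjugate-linear in $\ell$. *)

theory Defs
  imports "HOL-Complex_Analysis.Complex_Analysis"
begin

section \<open>Complex Hilbert spaces and bounded complex-linear operators\<close>

text \<open>The inner product is conjugate-linear in its first argument.\<close>

class complex_hilbert_space = real_normed_vector + complete_space +
  fixes scaleC :: "complex \<Rightarrow> 'a \<Rightarrow> 'a" (infixr "*\<^sub>C" 75)
    and cinner :: "'a \<Rightarrow> 'a \<Rightarrow> complex"
  assumes scaleC_complex_of_real: "scaleC (complex_of_real a) x = scaleR a x"
    and scaleC_add_right: "scaleC c (x + y) = scaleC c x + scaleC c y"
    and scaleC_add_left: "scaleC (c + d) x = scaleC c x + scaleC d x"
    and scaleC_scaleC: "scaleC c (scaleC d x) = scaleC (c * d) x"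
    and cinner_commute: "cinner x y = cnj (cinner y x)"
    and cinner_add_right: "cinner x (y + z) = cinner x y + cinner x z"
    and cinner_scaleC_right: "cinner x (scaleC c y) = c * cinner x y"
    and cinner_self: "cinner x x = complex_of_real ((norm x)\<^sup>2)"
begin

subclass banach ..

end

global_interpretation complex_vector:
  vector_space "scaleC :: complex \<Rightarrow> 'a \<Rightarrow> 'a::complex_hilbert_space"
proof
  show "1 *\<^sub>C x = x" for x :: 'a
    using scaleC_complex_of_real[of 1 x] by simp
qed (simp_all add: scaleC_add_right scaleC_add_left scaleC_scaleC)

lemma norm_scaleC:
  fixes x :: "'a::complex_hilbert_space"
  shows "norm (c *\<^sub>C x) = cmod c * norm x"
proof -
  have "complex_of_real ((norm (c *\<^sub>C x))\<^sup>2) = cinner (c *\<^sub>C x) (c *\<^sub>C x)"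
    by (rule cinner_self[symmetric])
  also have "\<dots> = c * cnj (cinner x (c *\<^sub>C x))"
    by (subst cinner_scaleC_right, subst cinner_commute) simp
  also have "\<dots> = (c * cnj c) * cnj (cinner x x)"
    by (simp add: cinner_scaleC_right)
  also have "\<dots> = complex_of_real ((cmod c * norm x)\<^sup>2)"
    by (simp add: cinner_self power_mult_distrib flip: complex_norm_square)
  finally have "(norm (c *\<^sub>C x))\<^sup>2 = (cmod c * norm x)\<^sup>2"
    using of_real_eq_iff by blast
  then show ?thesis by simp
qed

lemma bounded_linear_scaleC:
  "bounded_linear (scaleC c :: 'a \<Rightarrow> 'a::complex_hilbert_space)"
proof (rule bounded_linear_intro)
  show "c *\<^sub>C (x + y) = c *\<^sub>C x + c *\<^sub>C y" for x y :: 'a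
    by (rule scaleC_add_right)
  show "c *\<^sub>C (r *\<^sub>R x) = r *\<^sub>R (c *\<^sub>C x)" for r and x :: 'a
    by (simp add: scaleC_scaleC mult.commute flip: scaleC_complex_of_real)
  show "norm (c *\<^sub>C x) \<le> norm x * cmod c" for x :: 'a
    by (simp add: norm_scaleC)
qed

text \<open>The type \<open>'h \<Rightarrow>\<^sub>L 'h\<close> consists of bounded real-linear maps.  The algebra of bounded operators
  on the complex Hilbert space is its closed subset cut out by \<open>complex_linear\<close>; on that subset the
  operator norm is the norm of \<open>'h \<Rightarrow>\<^sub>L 'h\<close>.\<close>

definition complex_linear :: "('h::complex_hilbert_space \<Rightarrow>\<^sub>L 'h) \<Rightarrow> bool" where
  "complex_linear A \<longleftrightarrow> (\<forall>c x. blinfun_apply A (c *\<^sub>C x) = c *\<^sub>C blinfun_apply A x)"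

definition scale_op :: "complex \<Rightarrow> ('h::complex_hilbert_space \<Rightarrow>\<^sub>L 'h) \<Rightarrow> 'h \<Rightarrow>\<^sub>L 'h" where
  "scale_op c A = Blinfun (\<lambda>x. c *\<^sub>C blinfun_apply A x)"

definition resolvent_set :: "('h::complex_hilbert_space \<Rightarrow>\<^sub>L 'h) \<Rightarrow> complex set" where
  "resolvent_set A = {\<zeta>. \<exists>S. (scale_op \<zeta> id_blinfun - A) o\<^sub>L S = id_blinfun \<and>
                            S o\<^sub>L (scale_op \<zeta> id_blinfun - A) = id_blinfun}"

definition spectrum :: "('h::complex_hilbert_space \<Rightarrow>\<^sub>L 'h) \<Rightarrow> complex set" where
  "spectrum A = - resolvent_set A"

definition resolvent :: "('h::complex_hilbert_space \<Rightarrow>\<^sub>L 'h) \<Rightarrow> complex \<Rightarrow> 'h \<Rightarrow>\<^sub>L 'h" where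
  "resolvent A \<zeta> = (THE S. (scale_op \<zeta> id_blinfun - A) o\<^sub>L S = id_blinfun \<and>
                           S o\<^sub>L (scale_op \<zeta> id_blinfun - A) = id_blinfun)"

definition positive_contour :: "(real \<Rightarrow> complex) \<Rightarrow> bool" where
  "positive_contour \<gamma> \<longleftrightarrow> valid_path \<gamma> \<and> simple_path \<gamma> \<and> pathfinish \<gamma> = pathstart \<gamma> \<and>
     (\<forall>z \<in> inside (path_image \<gamma>). winding_number \<gamma> z = 1)"

definition encloses_cluster :: "(real \<Rightarrow> complex) \<Rightarrow> ('h::complex_hilbert_space \<Rightarrow>\<^sub>L 'h) \<Rightarrow> bool" where
  "encloses_cluster \<gamma> A \<longleftrightarrow>
     path_image \<gamma> \<subseteq> resolvent_set A \<and> spectrum A \<inter> inside (path_image \<gamma>) \<noteq> {}"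

text \<open>The library's \<open>contour_integral\<close> is scalar-valued; this is the same formula with an
  operator-valued integrand, integrated in operator norm.\<close>

definition riesz_projection ::
    "(real \<Rightarrow> complex) \<Rightarrow> ('h::complex_hilbert_space \<Rightarrow>\<^sub>L 'h) \<Rightarrow> 'h \<Rightarrow>\<^sub>L 'h" where
  "riesz_projection \<gamma> A = scale_op (1 / (2 * of_real pi * \<i>))
     (integral {0..1} (\<lambda>s. scale_op (vector_derivative \<gamma> (at s within {0..1})) (resolvent A (\<gamma> s))))"

text \<open>For a map \<open>A\<close> from the subspace \<open>X\<close> into some subspace \<open>Y\<close>, the values of its Hilbert adjoint
  \<open>Y \<rightarrow> X\<close> at points of \<open>Y\<close>.\<close>

definition hilbert_adjoint ::
    "'h::complex_hilbert_space set \<Rightarrow> ('h \<Rightarrow> 'h) \<Rightarrow> 'h \<Rightarrow> 'h" where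
  "hilbert_adjoint X A y = (THE x. x \<in> X \<and> (\<forall>z\<in>X. cinner x z = cinner y (A z)))"

definition opnorm_on :: "'h::complex_hilbert_space set \<Rightarrow> ('h \<Rightarrow> 'h) \<Rightarrow> real" where
  "opnorm_on X A = (SUP x \<in> {x \<in> X. norm x \<le> 1}. norm (A x))"

text \<open>With \<open>T\<close> the operator and \<open>P\<close> its Riesz projection: \<open>U\<close> is \<open>P\<close> restricted to \<open>E\<close>, so that its
  inverse is \<open>inv_into E P\<close>; \<open>V\<close> is determined by the prescription \<open>V\<^sup>\<dagger> = U\<^sup>-\<^sup>1 P : H \<rightarrow> E\<close>, that is,
  \<open>V = (U\<^sup>-\<^sup>1 P)\<^sup>\<dagger> : E \<rightarrow> H\<close>.\<close>

definition U_map :: "('h::complex_hilbert_space \<Rightarrow>\<^sub>L 'h) \<Rightarrow> 'h set \<Rightarrow> 'h \<Rightarrow> 'h" where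
  "U_map P E = restrict (blinfun_apply P) E"

definition M_map :: "('h::complex_hilbert_space \<Rightarrow>\<^sub>L 'h) \<Rightarrow> ('h \<Rightarrow>\<^sub>L 'h) \<Rightarrow> 'h set \<Rightarrow> 'h \<Rightarrow> 'h" where
  "M_map T P E x = inv_into E (U_map P E) (blinfun_apply T (U_map P E x))"

definition V_map :: "('h::complex_hilbert_space \<Rightarrow>\<^sub>L 'h) \<Rightarrow> 'h set \<Rightarrow> 'h \<Rightarrow> 'h" where
  "V_map P E = hilbert_adjoint UNIV (\<lambda>x. inv_into E (U_map P E) (blinfun_apply P x))"


section \<open>Smooth compact boundaries in three-space\<close>

primrec C_k_on :: "nat \<Rightarrow> 'a::euclidean_space set \<Rightarrow> ('a \<Rightarrow> 'b::real_normed_vector) \<Rightarrow> bool" where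
  "C_k_on 0 U f \<longleftrightarrow> continuous_on U f"
| "C_k_on (Suc n) U f \<longleftrightarrow> (\<forall>x\<in>U. f differentiable (at x)) \<and>
     (\<forall>b\<in>Basis. C_k_on n U (\<lambda>x. frechet_derivative f (at x) b))"

definition C_infinity_on :: "'a::euclidean_space set \<Rightarrow> ('a \<Rightarrow> 'b::real_normed_vector) \<Rightarrow> bool" where
  "C_infinity_on U f \<longleftrightarrow> (\<forall>n. C_k_on n U f)"

definition local_defining :: "(real^3) set \<Rightarrow> (real^3) set \<Rightarrow> (real^3 \<Rightarrow> real) \<Rightarrow> bool" where
  "local_defining \<Omega> U f \<longleftrightarrow> open U \<and> C_infinity_on U f \<and>
     (\<forall>x\<in>U. frechet_derivative f (at x) \<noteq> (\<lambda>h. 0)) \<and> \<Omega> \<inter> U = {x \<in> U. f x < 0}"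

text \<open>A smooth compact boundary is presented as \<open>\<Gamma> = frontier \<Omega>\<close> with \<open>\<Omega>\<close> a bounded smooth open set
  (not necessarily connected); \<open>\<Gamma>\<close> determines \<open>\<Omega>\<close>, and outward means out of \<open>\<Omega>\<close>.\<close>

definition smooth_domain :: "(real^3) set \<Rightarrow> bool" where
  "smooth_domain \<Omega> \<longleftrightarrow> open \<Omega> \<and> bounded \<Omega> \<and>
     (\<forall>p \<in> frontier \<Omega>. \<exists>U f. p \<in> U \<and> local_defining \<Omega> U f)"

definition outward_normal :: "(real^3) set \<Rightarrow> real^3 \<Rightarrow> real^3" where
  "outward_normal \<Omega> p = (THE n. norm n = 1 \<and>
     (\<exists>U f c. p \<in> U \<and> local_defining \<Omega> U f \<and> c > 0 \<and> (f has_derivative (\<lambda>h. c * (n \<bullet> h))) (at p)))"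

text \<open>Surface measure is two-dimensional Hausdorff measure, normalised by \<open>pi / 4\<close> so as to agree
  with area.\<close>

definition hausdorff_2 :: "(real^3) set \<Rightarrow> ennreal" where
  "hausdorff_2 A = (SUP \<delta> \<in> {0 <..}.
     INF C \<in> {C :: nat \<Rightarrow> (real^3) set.
                A \<subseteq> (\<Union>i. C i) \<and> (\<forall>i. bounded (C i) \<and> diameter (C i) \<le> (\<delta>::real))}.
       (\<Sum>i. ennreal (pi / 4 * (diameter (C i))\<^sup>2)))"

definition surface_measure :: "(real^3) set \<Rightarrow> (real^3) measure" where
  "surface_measure \<Omega> = measure_of (frontier \<Omega>) (sets (restrict_space borel (frontier \<Omega>))) hausdorff_2"

text \<open>The derivative of a function on \<open>\<Gamma>\<close> at \<open>p\<close> within \<open>\<Gamma>\<close> is determined on tangent vectors only; it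
  is extended by zero in the normal direction.  With \<open>\<delta>\<^sub>b\<close> the derivative in direction \<open>b\<close> so
  obtained, the Laplace-Beltrami operator (surface divergence of the surface gradient) is
  \<open>\<Sum>\<^sub>b \<delta>\<^sub>b \<delta>\<^sub>b\<close> over the Cartesian directions \<open>b\<close>.\<close>

definition tangential_derivative ::
    "(real^3) set \<Rightarrow> (real^3 \<Rightarrow> complex) \<Rightarrow> real^3 \<Rightarrow> real^3 \<Rightarrow> complex" where
  "tangential_derivative \<Omega> u p = (THE D. (u has_derivative D) (at p within frontier \<Omega>) \<and>
                                        D (outward_normal \<Omega> p) = 0)"

definition laplace_beltrami :: "(real^3) set \<Rightarrow> (real^3 \<Rightarrow> complex) \<Rightarrow> real^3 \<Rightarrow> complex" where
  "laplace_beltrami \<Omega> u p =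
     (\<Sum>b\<in>Basis. tangential_derivative \<Omega> (\<lambda>q. tangential_derivative \<Omega> u q b) p b)"


section \<open>The space \<open>H\<^sub>\<Gamma>\<close>\<close>

text \<open>Functions on \<open>\<Gamma>\<close> are functions on the ambient space whose values off \<open>\<Gamma>\<close> are irrelevant.\<close>

definition L2_functions :: "(real^3) set \<Rightarrow> (real^3 \<Rightarrow> complex) set" where
  "L2_functions \<Omega> = {\<phi> \<in> borel_measurable (surface_measure \<Omega>).
     integrable (surface_measure \<Omega>) (\<lambda>x. (cmod (\<phi> x))\<^sup>2)}"

definition L2_inner :: "(real^3) set \<Rightarrow> (real^3 \<Rightarrow> complex) \<Rightarrow> (real^3 \<Rightarrow> complex) \<Rightarrow> complex" where
  "L2_inner \<Omega> \<phi> \<psi> = (\<integral>x. cnj (\<phi> x) * \<psi> x \<partial>surface_measure \<Omega>)"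

definition laplace_eigenfunction :: "(real^3) set \<Rightarrow> real \<Rightarrow> (real^3 \<Rightarrow> complex) \<Rightarrow> bool" where
  "laplace_eigenfunction \<Omega> \<mu> e \<longleftrightarrow> C_infinity_on UNIV e \<and>
     (\<forall>x \<in> frontier \<Omega>. - laplace_beltrami \<Omega> e x = of_real \<mu> * e x)"

text \<open>The relation \<open>\<psi> = (k\<^sup>2 - \<Delta>\<^sub>\<Gamma>)\<^sup>s \<phi>\<close> in the sense of the functional calculus.  Since \<open>\<Gamma>\<close> is compact,
  the nonnegative self-adjoint operator \<open>-\<Delta>\<^sub>\<Gamma>\<close> on \<open>L\<^sup>2(\<Gamma>)\<close> is diagonalised by smooth eigenfunctions,
  so comparing coefficients against all of them determines \<open>\<psi>\<close> up to null sets; smooth functions on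
  \<open>\<Gamma>\<close> are the restrictions of smooth functions on the ambient space.\<close>

definition bessel_power ::
    "(real^3) set \<Rightarrow> real \<Rightarrow> real \<Rightarrow> (real^3 \<Rightarrow> complex) \<Rightarrow> (real^3 \<Rightarrow> complex) \<Rightarrow> bool" where
  "bessel_power \<Omega> k s \<phi> \<psi> \<longleftrightarrow> \<psi> \<in> L2_functions \<Omega> \<and>
     (\<forall>\<mu> e. laplace_eigenfunction \<Omega> \<mu> e \<longrightarrow>
        L2_inner \<Omega> e \<psi> = of_real ((k\<^sup>2 + \<mu>) powr s) * L2_inner \<Omega> e \<phi>)"

definition H_functions :: "(real^3) set \<Rightarrow> real \<Rightarrow> (real^3 \<Rightarrow> complex) set" where
  "H_functions \<Omega> k = {\<phi> \<in> L2_functions \<Omega>. \<exists>\<psi>. bessel_power \<Omega> k (1/4) \<phi> \<psi>}"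

definition H_inner ::
    "(real^3) set \<Rightarrow> real \<Rightarrow> (real^3 \<Rightarrow> complex) \<Rightarrow> (real^3 \<Rightarrow> complex) \<Rightarrow> complex" where
  "H_inner \<Omega> k \<phi> \<psi> =
     L2_inner \<Omega> (SOME f. bessel_power \<Omega> k (1/4) \<phi> f) (SOME g. bessel_power \<Omega> k (1/4) \<psi> g)"

text \<open>\<open>H\<^sub>\<Gamma>\<close> consists of classes of functions modulo equality almost everywhere, and depends on \<open>\<Gamma>\<close> and
  \<open>k\<close>.  \<open>H_model \<Omega> k q\<close> says that the Hilbert space \<open>'h\<close> is \<open>H\<^sub>\<Gamma>\<close>, where \<open>q\<close> sends a function to its
  class.\<close>

definition H_model ::
    "(real^3) set \<Rightarrow> real \<Rightarrow> ((real^3 \<Rightarrow> complex) \<Rightarrow> 'h::complex_hilbert_space) \<Rightarrow> bool" where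
  "H_model \<Omega> k q \<longleftrightarrow> q ` H_functions \<Omega> k = UNIV \<and>
     (\<forall>\<phi> \<in> H_functions \<Omega> k. \<forall>\<psi> \<in> H_functions \<Omega> k.
        (q \<phi> = q \<psi> \<longleftrightarrow> (AE x in surface_measure \<Omega>. \<phi> x = \<psi> x)) \<and>
        q (\<lambda>x. \<phi> x + \<psi> x) = q \<phi> + q \<psi> \<and>
        cinner (q \<phi>) (q \<psi>) = H_inner \<Omega> k \<phi> \<psi>) \<and>
     (\<forall>c. \<forall>\<phi> \<in> H_functions \<Omega> k. q (\<lambda>x. c * \<phi> x) = c *\<^sub>C q \<phi>)"


section \<open>Boundary operators and the weighted symbol\<close>

definition green :: "real \<Rightarrow> real^3 \<Rightarrow> real^3 \<Rightarrow> complex" where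
  "green k x y = exp (\<i> * of_real (k * norm (x - y))) / of_real (4 * pi * norm (x - y))"

definition green_normal :: "(real^3) set \<Rightarrow> real \<Rightarrow> real^3 \<Rightarrow> real^3 \<Rightarrow> complex" where
  "green_normal \<Omega> k x y = frechet_derivative (\<lambda>x'. green k x' y) (at x) (outward_normal \<Omega> x)"

definition combined_kernel :: "(real^3) set \<Rightarrow> real \<Rightarrow> real \<Rightarrow> real^3 \<Rightarrow> real^3 \<Rightarrow> complex" where
  "combined_kernel \<Omega> k \<eta> x z = green_normal \<Omega> k x z - \<i> * of_real (\<eta> * k) * green k x z"

definition single_layer :: "(real^3) set \<Rightarrow> real \<Rightarrow> (real^3 \<Rightarrow> complex) \<Rightarrow> real^3 \<Rightarrow> complex" where
  "single_layer \<Omega> k \<phi> x = (\<integral>y. green k x y * \<phi> y \<partial>surface_measure \<Omega>)"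

definition adjoint_double_layer ::
    "(real^3) set \<Rightarrow> real \<Rightarrow> (real^3 \<Rightarrow> complex) \<Rightarrow> real^3 \<Rightarrow> complex" where
  "adjoint_double_layer \<Omega> k \<phi> x = Lim (at_right (0::real))
     (\<lambda>\<delta>. \<integral>y. (if \<delta> < dist x y then green_normal \<Omega> k x y * \<phi> y else 0) \<partial>surface_measure \<Omega>)"

definition boundary_map ::
    "(real^3) set \<Rightarrow> real \<Rightarrow> real \<Rightarrow> real \<Rightarrow> int \<Rightarrow> (real^3 \<Rightarrow> complex) \<Rightarrow> real^3 \<Rightarrow> complex" where
  "boundary_map \<Omega> k \<eta> lam n \<phi> x =
     (if n = 0
      then \<phi> x / 2 + adjoint_double_layer \<Omega> k \<phi> x - \<i> * of_real (\<eta> * k) * single_layer \<Omega> k \<phi> x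
      else of_real (lam powi n) *
             (\<integral>y. combined_kernel \<Omega> k \<eta> x ((lam powi n) *\<^sub>R y) * \<phi> y \<partial>surface_measure \<Omega>))"

text \<open>The bounded operator induced on classes by a map of representatives (there is at most one when
  \<open>q\<close> maps onto \<open>'h\<close>).  As with \<open>infsum\<close>, the value is \<open>0\<close> where nothing is defined; the mapping
  properties of layer potentials on \<open>H\<^sub>\<Gamma>\<close> exclude that case for \<open>boundary_map\<close>.\<close>

definition induces ::
    "(real^3) set \<Rightarrow> real \<Rightarrow> ((real^3 \<Rightarrow> complex) \<Rightarrow> 'h::complex_hilbert_space) \<Rightarrow>
     ((real^3 \<Rightarrow> complex) \<Rightarrow> real^3 \<Rightarrow> complex) \<Rightarrow> ('h \<Rightarrow>\<^sub>L 'h) \<Rightarrow> bool" where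
  "induces \<Omega> k q F B \<longleftrightarrow> complex_linear B \<and>
     (\<forall>\<phi> \<in> H_functions \<Omega> k. F \<phi> \<in> H_functions \<Omega> k \<and> blinfun_apply B (q \<phi>) = q (F \<phi>))"

definition boundary_operator ::
    "(real^3) set \<Rightarrow> real \<Rightarrow> ((real^3 \<Rightarrow> complex) \<Rightarrow> 'h::complex_hilbert_space) \<Rightarrow>
     real \<Rightarrow> real \<Rightarrow> int \<Rightarrow> 'h \<Rightarrow>\<^sub>L 'h" where
  "boundary_operator \<Omega> k q \<eta> lam n =
     (if \<exists>B. induces \<Omega> k q (boundary_map \<Omega> k \<eta> lam n) B
      then THE B. induces \<Omega> k q (boundary_map \<Omega> k \<eta> lam n) B else 0)"

definition weighted_symbol ::
    "(real^3) set \<Rightarrow> real \<Rightarrow> ((real^3 \<Rightarrow> complex) \<Rightarrow> 'h::complex_hilbert_space) \<Rightarrow>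
     real \<Rightarrow> real \<Rightarrow> real \<Rightarrow> real \<Rightarrow> 'h \<Rightarrow>\<^sub>L 'h" where
  "weighted_symbol \<Omega> k q \<eta> lam \<beta> t =
     (\<Sum>\<^sub>\<infinity>n\<in>(UNIV::int set).
        scale_op (exp (- \<i> * of_int n * of_real t) * of_real (lam powr (\<beta> * of_int n)))
                 (boundary_operator \<Omega> k q \<eta> lam n))"

end

theory Submission
  imports Defs
begin

text \<open>
  The symbol enters only as a bounded complex-linear operator \<open>T\<close> with \<open>\<parallel>T - T_ref\<parallel> \<le> \<epsilon>\<close>.  A Neumann series
  shows that on a neighbourhood of the contour the resolvents of \<open>T\<close> and \<open>T_ref\<close> differ by \<open>O(\<epsilon>)\<close>,
  hence so do the Riesz projections \<open>P\<close> and \<open>Q\<close> (\<open>riesz_projection_perturbation\<close>).  Both are idempotent and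
  commute with their operators (\<open>contour_projection\<close>), and two projections at small distance have
  isomorphic ranges.

  The estimates rest on one formula.  Let \<open>J = U\<^sup>-\<^sup>1 P\<close> (\<open>lift\<close> below), the projection onto \<open>E\<close>
  along the kernel of \<open>P\<close>.
  Since \<open>Q\<close> fixes \<open>J z\<close> and \<open>P\<close> kills \<open>J z - z\<close>,
  \<open>J z - Q z = (Q - P) (J z - z)\<close>.
  As \<open>J\<close> is bounded, \<open>J - Q = O(\<epsilon>)\<close>, and taking adjoints gives the bound on \<open>V = J\<^sup>\<dagger>\<close>.  Moreover
  \<open>M x = J (T x)\<close> on \<open>E\<close>, and for \<open>z = T x\<close> both factors on the right are \<open>O(\<epsilon>)\<close>, because \<open>T\<close> almost maps
  \<open>E\<close> into itself; this makes \<open>M - Q T\<close> quadratically small.  The statements on eigenvectors follow from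
  \<open>P M = T P\<close> and \<open>M J = J T\<close>.

  Two points need more than the textbook argument.  A contour is only piecewise \<open>C\<^sup>1\<close> with finitely
  many exceptional parameters, near which its derivative may be unbounded, so it need not be
  rectifiable.  The operator-valued contour integral therefore exists not by continuity of the integrand
  but because the resolvent has local primitives; scalar integrals are then moved to a nearby
  polynomial loop where Cauchy transforms are to be differentiated.  Idempotence of Riesz projections is derived from a single
  contour rather than a nested pair (\<open>P_idempotent\<close>).

  About the symbol itself two facts are used: it is complex-linear, and it is \<open>2\<pi>\<close>-periodic and bounded
  in \<open>t\<close>, so that the supremum \<open>\<epsilon>\<close> really bounds every \<open>\<parallel>T(t) - T_ref\<parallel>\<close>.  Boundedness is a general property
  of unconditionally convergent series multiplied by phases (\<open>weighted_symbol_bounded\<close>).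
\<close>

section \<open>Inner products, Riesz representation and adjoints\<close>

lemma cinner_add_left: "cinner (x + y) z = cinner x z + cinner y z"
  for x y z :: "'h::complex_hilbert_space"
  by (metis cinner_add_right cinner_commute complex_cnj_add)

lemma cinner_scaleC_left: "cinner (c *\<^sub>C x) y = cnj c * cinner x y"
  for x y :: "'h::complex_hilbert_space"
  by (metis cinner_commute cinner_scaleC_right complex_cnj_mult)

lemma cinner_scaleR_right: "cinner x (r *\<^sub>R y) = of_real r * cinner x y"
  for x y :: "'h::complex_hilbert_space"
  by (metis cinner_scaleC_right scaleC_complex_of_real)

lemma cinner_zero_right [simp]: "cinner x 0 = 0" for x :: "'h::complex_hilbert_space"
  using cinner_scaleR_right[of x 0 0] by simp

lemma cinner_zero_left [simp]: "cinner 0 x = 0" for x :: "'h::complex_hilbert_space"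
  by (metis cinner_commute cinner_zero_right complex_cnj_zero)

lemma cinner_diff_right: "cinner x (y - z) = cinner x y - cinner x z"
  for x y z :: "'h::complex_hilbert_space"
  by (metis add_diff_cancel cinner_add_right diff_add_cancel)

lemma cinner_diff_left: "cinner (x - y) z = cinner x z - cinner y z"
  for x y z :: "'h::complex_hilbert_space"
  by (metis add_diff_cancel cinner_add_left diff_add_cancel)

lemma cinner_ext: "x = y" if "\<And>z. cinner z x = cinner z y"
  for x y :: "'h::complex_hilbert_space"
  using that[of "x - y"] cinner_self[of "x - y"] by (simp add: cinner_diff_right)

lemma scaleC_diff_right: "c *\<^sub>C (x - y) = c *\<^sub>C x - c *\<^sub>C y"
  for x y :: "'h::complex_hilbert_space"
  by (rule complex_vector.scale_right_diff_distrib)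

lemma cinner_Cauchy_Schwarz: "cmod (cinner x y) \<le> norm x * norm y"
  for x y :: "'h::complex_hilbert_space"
proof (cases "x = 0")
  case False
  define a where "a = cinner x y"
  define z where "z = of_real ((norm x)\<^sup>2) *\<^sub>C y - a *\<^sub>C x"
  have xz: "cinner x z = 0"
    by (simp add: z_def cinner_diff_right cinner_scaleC_right cinner_self a_def)
  have "cinner z z = of_real ((norm x)\<^sup>2) * cinner y z"
    by (subst (1) z_def) (simp add: cinner_diff_left cinner_scaleC_left xz)
  also have "\<dots> = of_real ((norm x)\<^sup>2) * (of_real ((norm x)\<^sup>2 * (norm y)\<^sup>2) - a * cnj a)"
    using cinner_commute[of y x]
    by (simp add: z_def cinner_diff_right cinner_scaleC_right cinner_self a_def)
  also have "\<dots> = of_real ((norm x)\<^sup>2 * ((norm x)\<^sup>2 * (norm y)\<^sup>2 - (cmod a)\<^sup>2))"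
    by (simp flip: complex_norm_square)
  finally have "(norm z)\<^sup>2 = (norm x)\<^sup>2 * ((norm x)\<^sup>2 * (norm y)\<^sup>2 - (cmod a)\<^sup>2)"
    unfolding cinner_self using of_real_eq_iff by blast
  then have "0 \<le> (norm x)\<^sup>2 * ((norm x)\<^sup>2 * (norm y)\<^sup>2 - (cmod a)\<^sup>2)"
    by (metis zero_le_power2)
  then have "(cmod a)\<^sup>2 \<le> (norm x * norm y)\<^sup>2"
    using False by (simp add: zero_le_mult_iff power_mult_distrib)
  then show ?thesis
    by (simp add: a_def power2_le_iff_abs_le)
qed simp

lemma bounded_linear_cinner_right: "bounded_linear (cinner x)" for x :: "'h::complex_hilbert_space"
  by (rule bounded_linear_intro[where K = "norm x"])
    (simp_all add: cinner_add_right cinner_scaleR_right scaleR_conv_of_real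
      cinner_Cauchy_Schwarz[of x, simplified mult.commute[of "norm x"]])

lemma cinner_commute_Re: "Re (cinner y x) = Re (cinner x y)" for x y :: "'h::complex_hilbert_space"
  by (metis cinner_commute cnj.sel(1))

lemma norm_add_square: "(norm (x + y))\<^sup>2 = (norm x)\<^sup>2 + 2 * Re (cinner x y) + (norm y)\<^sup>2"
  for x y :: "'h::complex_hilbert_space"
proof -
  have "(norm z)\<^sup>2 = Re (cinner z z)" for z :: 'h
    by (simp only: cinner_self Re_complex_of_real)
  then show ?thesis
    by (simp add: cinner_add_left cinner_add_right cinner_commute_Re[of x y])
qed

lemma parallelogram_law: "(norm (x + y))\<^sup>2 + (norm (x - y))\<^sup>2 = 2 * (norm x)\<^sup>2 + 2 * (norm y)\<^sup>2"
  for x y :: "'h::complex_hilbert_space"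
  using norm_add_square[of x y] norm_add_square[of x "- y"] cinner_diff_right[of x 0 y] by simp

text \<open>The representing vector minimises \<open>\<parallel>x\<parallel>\<^sup>2 - 2 Re f(x)\<close> over the subspace: by the parallelogram law
  minimising sequences are Cauchy, and the vanishing of the directional derivatives at the minimum
  is the representation formula.\<close>

lemma riesz_representation:
  fixes f :: "'h::complex_hilbert_space \<Rightarrow> complex"
  assumes clX: "closed X" and subX: "complex_vector.subspace X"
    and add: "\<And>x y. x \<in> X \<Longrightarrow> y \<in> X \<Longrightarrow> f (x + y) = f x + f y"
    and scale: "\<And>c x. x \<in> X \<Longrightarrow> f (c *\<^sub>C x) = c * f x"
    and bnd: "\<And>x. x \<in> X \<Longrightarrow> cmod (f x) \<le> K * norm x"
  obtains x where "x \<in> X" "\<And>z. z \<in> X \<Longrightarrow> cinner x z = f z"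
proof -
  define J where "J x = (norm x)\<^sup>2 - 2 * Re (f x)" for x
  have X0: "0 \<in> X" and Xadd: "\<And>x y. x \<in> X \<Longrightarrow> y \<in> X \<Longrightarrow> x + y \<in> X"
    and Xscale: "\<And>c x. x \<in> X \<Longrightarrow> c *\<^sub>C x \<in> X"
    using subX by (auto simp: complex_vector.subspace_def)
  have XscaleR: "r *\<^sub>R x \<in> X" if "x \<in> X" for r x
    using Xscale[OF that, of "of_real r"] by (simp add: scaleC_complex_of_real)
  have scaleR: "f (r *\<^sub>R x) = of_real r * f x" if "x \<in> X" for r x
    using scale[OF that, of "of_real r"] by (simp add: scaleC_complex_of_real)
  have lower: "- K\<^sup>2 \<le> J x" if "x \<in> X" for x
  proof -
    have "Re (f x) \<le> K * norm x"
      using bnd[OF that] complex_Re_le_cmod[of "f x"] by linarith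
    moreover have "0 \<le> (norm x - K)\<^sup>2" by simp
    ultimately show ?thesis by (simp add: J_def power2_diff algebra_simps)
  qed
  define m where "m = Inf (J ` X)"
  have bdd: "bdd_below (J ` X)"
    using lower by (auto intro!: bdd_belowI2)
  have m_le: "m \<le> J x" if "x \<in> X" for x
    unfolding m_def using that bdd by (simp add: cInf_lower)
  have "\<exists>x\<in>X. J x < m + 1 / real (Suc n)" for n
  proof -
    have "m < m + 1 / real (Suc n)" by simp
    then show ?thesis
      using cInf_lessD[of "J ` X" "m + 1 / real (Suc n)"] X0 unfolding m_def by auto
  qed
  then obtain s where sX: "\<And>n. s n \<in> X" and sJ: "\<And>n. J (s n) < m + 1 / real (Suc n)"
    by metis
  \<comment> \<open>\<open>J\<close> is the square of a norm plus a linear term, so midpoints inherit the parallelogram law.\<close>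
  have dist_sq: "(norm (s i - s j))\<^sup>2 \<le> 2 * (1 / real (Suc i) + 1 / real (Suc j))" for i j
  proof -
    have "m \<le> J ((1/2) *\<^sub>R (s i + s j))"
      by (intro m_le XscaleR Xadd sX)
    also have "\<dots> = (norm (s i + s j))\<^sup>2 / 4 - Re (f (s i)) - Re (f (s j))"
      using sX by (simp add: J_def scaleR Xadd add power_divide add_divide_distrib)
    finally have "m \<le> (norm (s i + s j))\<^sup>2 / 4 - Re (f (s i)) - Re (f (s j))" .
    moreover have "D \<le> 2 * (a + b)"
      if "m \<le> S / 4 - p - q" "S + D = 2 * u + 2 * v" "u - 2 * p < m + a" "v - 2 * q < m + b"
      for D S p q u v a b :: real
      using that by argo
    ultimately show ?thesis
      using parallelogram_law[of "s i" "s j"] sJ[of i] sJ[of j] unfolding J_def by blast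
  qed
  have "Cauchy s"
  proof (rule metric_CauchyI)
    fix e :: real assume "0 < e"
    then obtain N where N: "1 / real (Suc N) < e\<^sup>2 / 4"
      using nat_approx_posE[of "e\<^sup>2 / 4"] by auto
    show "\<exists>M. \<forall>i\<ge>M. \<forall>j\<ge>M. dist (s i) (s j) < e"
    proof (intro exI allI impI)
      fix i j assume "N \<le> i" "N \<le> j"
      then have "1 / real (Suc i) \<le> 1 / real (Suc N)" "1 / real (Suc j) \<le> 1 / real (Suc N)"
        by (simp_all add: frac_le)
      then have "(norm (s i - s j))\<^sup>2 < e\<^sup>2"
        using dist_sq[of i j] N by argo
      then show "dist (s i) (s j) < e"
        using \<open>0 < e\<close> by (simp add: dist_norm power_less_imp_less_base)
    qed
  qed
  then obtain x where x: "s \<longlonglongrightarrow> x"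
    using Cauchy_convergent convergent_def by blast
  have xX: "x \<in> X"
    using clX sX x closed_sequentially by blast
  \<comment> \<open>Minimality is exploited along the sequence; only the inner product is then passed to the limit.\<close>
  have re: "Re (cinner x z) = Re (f z)" if z: "z \<in> X" for z
  proof -
    define b where "b = Re (cinner z x) - Re (f z)"
    have quad: "0 \<le> t\<^sup>2 * (norm z)\<^sup>2 + 2 * t * b" for t
    proof -
      have "0 \<le> t\<^sup>2 * (norm z)\<^sup>2 + 2 * t * (Re (cinner z (s n)) - Re (f z)) + 1 / real (Suc n)" for n
      proof -
        have "m \<le> J (s n + t *\<^sub>R z)"
          by (intro m_le XscaleR Xadd sX z)
        also have "\<dots> = J (s n) + t\<^sup>2 * (norm z)\<^sup>2 + 2 * t * (Re (cinner z (s n)) - Re (f z))"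
          using z sX XscaleR
          by (simp add: J_def norm_add_square add scaleR cinner_scaleR_right power_mult_distrib
              cinner_commute_Re[of "s n"] algebra_simps)
        finally show ?thesis using sJ[of n] by linarith
      qed
      moreover have "(\<lambda>n. t\<^sup>2 * (norm z)\<^sup>2 + 2 * t * (Re (cinner z (s n)) - Re (f z)) + 1 / real (Suc n))
          \<longlonglongrightarrow> t\<^sup>2 * (norm z)\<^sup>2 + 2 * t * (Re (cinner z x) - Re (f z)) + 0"
        by (intro tendsto_intros bounded_linear.tendsto[OF bounded_linear_cinner_right] x
            LIMSEQ_Suc[OF lim_1_over_n])
      ultimately show ?thesis
        unfolding b_def by (metis (no_types, lifting) LIMSEQ_le_const add_0_right)
    qed
    have "b = 0"
    proof (rule ccontr)
      assume "b \<noteq> 0"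
      \<comment> \<open>\<open>d\<close> exceeds \<open>\<parallel>z\<parallel>\<^sup>2\<close> so that \<open>t = - b / d\<close> makes sense for \<open>z = 0\<close> as well.\<close>
      define d where "d = (norm z)\<^sup>2 + 1"
      have d: "d > 0" "(norm z)\<^sup>2 = d - 1" by (auto simp: d_def add_nonneg_pos)
      have "(- b / d)\<^sup>2 * (norm z)\<^sup>2 + 2 * (- b / d) * b = - (b\<^sup>2 * (d + 1)) / d\<^sup>2"
        unfolding d(2) using d(1) by (simp add: power2_eq_square field_simps)
      moreover have "- (b\<^sup>2 * (d + 1)) / d\<^sup>2 < 0"
        using \<open>b \<noteq> 0\<close> d by (simp add: divide_neg_pos)
      ultimately show False
        using quad[of "- b / d"] by simp
    qed
    then show ?thesis by (simp add: b_def cinner_commute_Re[of x z])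
  qed
  have "cinner x z = f z" if "z \<in> X" for z
  proof (rule complex_eqI)
    show "Re (cinner x z) = Re (f z)" by (rule re[OF that])
    have "Re (cinner x (\<i> *\<^sub>C z)) = Re (f (\<i> *\<^sub>C z))"
      using that by (intro re Xscale)
    then show "Im (cinner x z) = Im (f z)"
      using that by (simp add: cinner_scaleC_right scale)
  qed
  with xX show thesis by (rule that)
qed

lemma hilbert_adjoint_eqI:
  fixes X :: "'h::complex_hilbert_space set"
  assumes "complex_vector.subspace X" "x \<in> X" "\<And>z. z \<in> X \<Longrightarrow> cinner x z = cinner y (A z)"
  shows "hilbert_adjoint X A y = x"
  unfolding hilbert_adjoint_def
proof (rule the_equality)
  show "x \<in> X \<and> (\<forall>z\<in>X. cinner x z = cinner y (A z))" using assms by blast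
next
  fix x' assume x': "x' \<in> X \<and> (\<forall>z\<in>X. cinner x' z = cinner y (A z))"
  then have "x' - x \<in> X"
    using assms complex_vector.subspace_diff by blast
  then have "cinner (x' - x) (x' - x) = 0"
    using x' assms(3) by (simp add: cinner_diff_left)
  then show "x' = x" by (simp add: cinner_self)
qed

text \<open>\<open>A\<close> is a map on \<open>X\<close> only, since it is applied to operators built from an inverse on a
  subspace.\<close>

lemma hilbert_adjoint_on:
  fixes X :: "'h::complex_hilbert_space set"
  assumes "closed X" and subX: "complex_vector.subspace X"
    and "\<And>x y. x \<in> X \<Longrightarrow> y \<in> X \<Longrightarrow> A (x + y) = A x + A y"
    and "\<And>c x. x \<in> X \<Longrightarrow> A (c *\<^sub>C x) = c *\<^sub>C A x"
    and bnd: "\<And>x. x \<in> X \<Longrightarrow> norm (A x) \<le> K * norm x"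
  shows "hilbert_adjoint X A y \<in> X"
    and "z \<in> X \<Longrightarrow> cinner (hilbert_adjoint X A y) z = cinner y (A z)"
proof -
  have "cmod (cinner y (A x)) \<le> (norm y * K) * norm x" if "x \<in> X" for x
    using order_trans[OF cinner_Cauchy_Schwarz mult_left_mono[OF bnd[OF that] norm_ge_zero]]
    by (simp add: mult.assoc)
  then obtain x where x: "x \<in> X" "\<And>z. z \<in> X \<Longrightarrow> cinner x z = cinner y (A z)"
    using riesz_representation[of X "\<lambda>z. cinner y (A z)" "norm y * K"] assms
    by (auto simp: cinner_add_right cinner_scaleC_right)
  then have "hilbert_adjoint X A y = x"
    using hilbert_adjoint_eqI[OF subX] by blast
  with x show "hilbert_adjoint X A y \<in> X"
    and "z \<in> X \<Longrightarrow> cinner (hilbert_adjoint X A y) z = cinner y (A z)" by auto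
qed

section \<open>Complex scaling and inversion of bounded operators\<close>

lemma scale_op_apply [simp]: "blinfun_apply (scale_op c A) x = c *\<^sub>C blinfun_apply A x"
proof -
  have "bounded_linear (\<lambda>x. c *\<^sub>C blinfun_apply A x)"
    by (intro bounded_linear_compose[OF bounded_linear_scaleC] blinfun.bounded_linear_right)
  then show ?thesis by (simp add: scale_op_def bounded_linear_Blinfun_apply)
qed

lemma bounded_bilinear_scale_op:
  "bounded_bilinear (scale_op :: complex \<Rightarrow> ('h::complex_hilbert_space \<Rightarrow>\<^sub>L 'h) \<Rightarrow> 'h \<Rightarrow>\<^sub>L 'h)"
proof
  fix a b :: complex and A B :: "'h \<Rightarrow>\<^sub>L 'h" and r :: real
  show "scale_op (a + b) A = scale_op a A + scale_op b A"
    by (rule blinfun_eqI) (simp add: blinfun.add_left scaleC_add_left)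
  show "scale_op a (A + B) = scale_op a A + scale_op a B"
    by (rule blinfun_eqI) (simp add: blinfun.add_left scaleC_add_right)
  show "scale_op (r *\<^sub>R a) A = r *\<^sub>R scale_op a A"
    by (rule blinfun_eqI)
      (simp add: blinfun.scaleR_left scaleC_scaleC scaleR_conv_of_real flip: scaleC_complex_of_real)
  show "scale_op a (r *\<^sub>R A) = r *\<^sub>R scale_op a A"
    by (rule blinfun_eqI)
      (simp add: blinfun.scaleR_left scaleC_scaleC mult.commute flip: scaleC_complex_of_real)
  show "\<exists>K. \<forall>a (A :: 'h \<Rightarrow>\<^sub>L 'h). norm (scale_op a A) \<le> norm a * norm A * K"
  proof (intro exI allI)
    fix a and A :: "'h \<Rightarrow>\<^sub>L 'h"
    have "norm (a *\<^sub>C A x) \<le> (cmod a * norm A) * norm x" for x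
      using mult_left_mono[OF norm_blinfun[of A x] norm_ge_zero[of a]] by (simp add: norm_scaleC mult.assoc)
    then show "norm (scale_op a A) \<le> norm a * norm A * 1"
      by (intro norm_blinfun_bound) auto
  qed
qed

interpretation scale_op: bounded_bilinear
  "scale_op :: complex \<Rightarrow> ('h::complex_hilbert_space \<Rightarrow>\<^sub>L 'h) \<Rightarrow> 'h \<Rightarrow>\<^sub>L 'h"
  by (rule bounded_bilinear_scale_op)

lemma norm_scale_op_le: "norm (scale_op c A) \<le> cmod c * norm A"
proof (rule norm_blinfun_bound)
  show "norm (blinfun_apply (scale_op c A) x) \<le> cmod c * norm A * norm x" for x
    using mult_left_mono[OF norm_blinfun[of A x] norm_ge_zero[of c]]
    by (simp add: norm_scaleC mult.assoc)
qed simp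

lemma scale_op_scale_op: "scale_op c (scale_op d A) = scale_op (c * d) A"
  by (rule blinfun_eqI) (simp add: scaleC_scaleC)

lemma complex_linearD: "complex_linear A \<Longrightarrow> blinfun_apply A (c *\<^sub>C x) = c *\<^sub>C blinfun_apply A x"
  by (simp add: complex_linear_def)

lemma complex_linear_scale_op: "complex_linear A \<Longrightarrow> complex_linear (scale_op c A)"
  by (simp add: complex_linear_def scaleC_scaleC mult.commute)

definition inverse_ops :: "('a::real_normed_vector \<Rightarrow>\<^sub>L 'a) \<Rightarrow> ('a \<Rightarrow>\<^sub>L 'a) \<Rightarrow> bool" where
  "inverse_ops X Y \<longleftrightarrow> X o\<^sub>L Y = id_blinfun \<and> Y o\<^sub>L X = id_blinfun"

lemma inverse_opsD:
  assumes "inverse_ops X Y"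
  shows "blinfun_apply X (blinfun_apply Y x) = x" "blinfun_apply Y (blinfun_apply X x) = x"
  using assms by (metis inverse_ops_def blinfun_apply_blinfun_compose blinfun_apply_id_blinfun id_apply)+

lemma inverse_opsI:
  assumes "\<And>x. blinfun_apply X (blinfun_apply Y x) = x" "\<And>x. blinfun_apply Y (blinfun_apply X x) = x"
  shows "inverse_ops X Y"
  using assms by (auto simp: inverse_ops_def intro!: blinfun_eqI)

lemma inverse_ops_unique: "inverse_ops X Y \<Longrightarrow> inverse_ops X Z \<Longrightarrow> Y = Z"
  by (rule blinfun_eqI) (metis inverse_opsD)

text \<open>The inverse maps \<open>y\<close> to the fixed point of the contraction \<open>x \<mapsto> y + A x\<close>; its norm bound is that of
  the Neumann series.\<close>

lemma id_minus_contraction_invertible: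
  fixes A :: "'a::banach \<Rightarrow>\<^sub>L 'a"
  assumes A: "norm A < 1"
  obtains S where "inverse_ops (id_blinfun - A) S" "norm S \<le> 1 / (1 - norm A)"
proof -
  have "\<exists>!x. x \<in> UNIV \<and> y + A x = x" for y
  proof -
    have "dist (y + A u) (y + A v) \<le> norm A * dist u v" for u v
      using norm_blinfun[of A "u - v"] by (simp add: dist_norm blinfun.diff_right)
    then show ?thesis
      using Banach_fix[of UNIV "norm A" "\<lambda>x. y + A x"] A complete_UNIV by simp
  qed
  then obtain g where g: "\<And>y. y + A (g y) = g y" and uniq: "\<And>x y. y + A x = x \<Longrightarrow> x = g y"
    by (metis UNIV_I)
  have "bounded_linear g"
  proof (rule bounded_linear_intro[where K = "1 / (1 - norm A)"])
    show "g (x + y) = g x + g y" for x y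
    proof (rule uniq[symmetric])
      have "(x + y) + A (g x + g y) = (x + A (g x)) + (y + A (g y))"
        by (simp only: blinfun.add_right ac_simps)
      then show "(x + y) + A (g x + g y) = g x + g y" by (simp only: g)
    qed
    show "g (r *\<^sub>R x) = r *\<^sub>R g x" for r x
      by (rule uniq[symmetric]) (simp only: blinfun.scaleR_right g flip: scaleR_right_distrib)
    show "norm (g x) \<le> norm x * (1 / (1 - norm A))" for x
    proof -
      have "norm (g x) \<le> norm x + norm A * norm (g x)"
        using norm_triangle_ineq[of x "A (g x)"] norm_blinfun[of A "g x"] unfolding g by linarith
      then show ?thesis using A by (simp add: field_simps)
    qed
  qed note bl = this
  show thesis
  proof (rule that)
    have appl: "blinfun_apply (Blinfun g) x = g x" for x
      by (simp add: bounded_linear_Blinfun_apply[OF bl])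
    show "inverse_ops (id_blinfun - A) (Blinfun g)"
    proof (rule inverse_opsI)
      show "(id_blinfun - A) (Blinfun g x) = x" for x
        using g[of x] by (simp add: appl blinfun.diff_left diff_eq_eq)
      show "Blinfun g ((id_blinfun - A) x) = x" for x
        using uniq[of "x - A x" x] by (simp add: appl blinfun.diff_left)
    qed
    show "norm (Blinfun g) \<le> 1 / (1 - norm A)"
    proof (rule norm_blinfun_bound)
      fix x
      have "norm (g x) \<le> norm x + norm A * norm (g x)"
        using norm_triangle_ineq[of x "A (g x)"] norm_blinfun[of A "g x"] unfolding g by linarith
      then show "norm (Blinfun g x) \<le> 1 / (1 - norm A) * norm x"
        using A by (simp add: appl field_simps)
    qed (use A in simp)
  qed
qed

lemma inverse_ops_perturb:
  fixes X Y D :: "'a::banach \<Rightarrow>\<^sub>L 'a"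
  assumes XY: "inverse_ops X Y" and K: "norm Y \<le> K" and D: "K * norm D \<le> 1 / 2"
  obtains Z where "inverse_ops (X - D) Z" "norm Z \<le> 2 * K"
proof -
  have "norm (Y o\<^sub>L D) \<le> K * norm D"
    using norm_blinfun_compose[of Y D] mult_right_mono[OF K norm_ge_zero[of D]] by linarith
  then have small: "norm (Y o\<^sub>L D) \<le> 1 / 2" using D by linarith
  then obtain S where S: "inverse_ops (id_blinfun - (Y o\<^sub>L D)) S"
    and nS: "norm S \<le> 1 / (1 - norm (Y o\<^sub>L D))"
    using id_minus_contraction_invertible[of "Y o\<^sub>L D"] by force
  have "1 / (1 - norm (Y o\<^sub>L D)) \<le> 2" using small by (simp add: field_simps)
  with nS have nS2: "norm S \<le> 2" by linarith
  have fact: "(X - D) x = X ((id_blinfun - (Y o\<^sub>L D)) x)" for x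
    by (simp add: blinfun.diff_left blinfun.diff_right inverse_opsD[OF XY])
  show thesis
  proof (rule that)
    show "inverse_ops (X - D) (S o\<^sub>L Y)"
      by (rule inverse_opsI) (simp_all only: fact blinfun_apply_blinfun_compose inverse_opsD[OF XY] inverse_opsD[OF S])
    show "norm (S o\<^sub>L Y) \<le> 2 * K"
      using norm_blinfun_compose[of S Y] mult_mono[OF nS2 K] by simp
  qed
qed

text \<open>The second resolvent identity \<open>Z - Y = Z D Y\<close>.\<close>

lemma norm_inverse_ops_diff:
  fixes X Y D Z :: "'a::real_normed_vector \<Rightarrow>\<^sub>L 'a"
  assumes "inverse_ops X Y" "inverse_ops (X - D) Z"
  shows "norm (Z - Y) \<le> norm Z * norm D * norm Y"
proof -
  have "Z - Y = Z o\<^sub>L (D o\<^sub>L Y)"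
  proof (rule blinfun_eqI)
    fix x
    have "Z x - Y x = Z (X (Y x)) - Z ((X - D) (Y x))"
      by (simp only: inverse_opsD[OF assms(1)] inverse_opsD[OF assms(2)])
    then show "(Z - Y) x = (Z o\<^sub>L (D o\<^sub>L Y)) x"
      by (simp add: blinfun.diff_left blinfun.diff_right)
  qed
  then show ?thesis
    using norm_blinfun_compose[of Z "D o\<^sub>L Y"]
      mult_left_mono[OF norm_blinfun_compose[of D Y] norm_ge_zero[of Z]]
    by (simp add: mult.assoc)
qed

lemma resolvent_set_iff:
  "\<zeta> \<in> resolvent_set A \<longleftrightarrow> (\<exists>S. inverse_ops (scale_op \<zeta> id_blinfun - A) S)"
  by (simp add: resolvent_set_def inverse_ops_def)

lemma resolvent_eqI:
  assumes "inverse_ops (scale_op \<zeta> id_blinfun - A) S"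
  shows "resolvent A \<zeta> = S"
  unfolding resolvent_def inverse_ops_def[symmetric]
  using assms inverse_ops_unique by blast

lemma resolvent_inverse:
  "\<zeta> \<in> resolvent_set A \<Longrightarrow> inverse_ops (scale_op \<zeta> id_blinfun - A) (resolvent A \<zeta>)"
  using resolvent_eqI resolvent_set_iff by metis

lemma resolvent_apply:
  assumes "\<zeta> \<in> resolvent_set A"
  shows "\<zeta> *\<^sub>C blinfun_apply (resolvent A \<zeta>) x - blinfun_apply A (blinfun_apply (resolvent A \<zeta>) x) = x"
    and "blinfun_apply (resolvent A \<zeta>) (\<zeta> *\<^sub>C x - blinfun_apply A x) = x"
  using inverse_opsD[OF resolvent_inverse[OF assms], of x] by (simp_all add: blinfun.diff_left)

lemma complex_linear_resolvent:
  assumes A: "complex_linear A" and z: "\<zeta> \<in> resolvent_set A"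
  shows "complex_linear (resolvent A \<zeta>)"
  unfolding complex_linear_def
proof (intro allI)
  fix c x
  let ?R = "resolvent A \<zeta>"
  have "\<zeta> *\<^sub>C (c *\<^sub>C ?R x) - A (c *\<^sub>C ?R x) = c *\<^sub>C (\<zeta> *\<^sub>C ?R x - A (?R x))"
    by (simp add: complex_linearD[OF A] scaleC_diff_right scaleC_scaleC mult.commute)
  then have "c *\<^sub>C x = \<zeta> *\<^sub>C (c *\<^sub>C ?R x) - A (c *\<^sub>C ?R x)"
    by (simp only: resolvent_apply(1)[OF z])
  then show "?R (c *\<^sub>C x) = c *\<^sub>C ?R x"
    using resolvent_apply(2)[OF z, of "c *\<^sub>C ?R x"] by simp
qed

lemma resolvent_commute:
  assumes z: "\<zeta> \<in> resolvent_set A" and A: "complex_linear A"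
  shows "blinfun_apply (resolvent A \<zeta>) (blinfun_apply A x) = blinfun_apply A (blinfun_apply (resolvent A \<zeta>) x)"
proof -
  let ?R = "resolvent A \<zeta>"
  have R: "complex_linear ?R" by (rule complex_linear_resolvent[OF A z])
  have "\<zeta> *\<^sub>C ?R x - A (?R x) = \<zeta> *\<^sub>C ?R x - ?R (A x)"
    using resolvent_apply[OF z, of x] by (simp add: blinfun.diff_right complex_linearD[OF R])
  then show ?thesis by simp
qed

lemma resolvent_identity:
  assumes A: "complex_linear A" and z: "z \<in> resolvent_set A" and w: "w \<in> resolvent_set A"
  shows "blinfun_apply (resolvent A z) x - blinfun_apply (resolvent A w) x
    = (w - z) *\<^sub>C blinfun_apply (resolvent A z) (blinfun_apply (resolvent A w) x)"
proof -
  let ?Z = "resolvent A z" and ?W = "resolvent A w"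
  have Z: "complex_linear ?Z" by (rule complex_linear_resolvent[OF A z])
  have "?Z x = ?Z (w *\<^sub>C ?W x - A (?W x))" by (simp add: resolvent_apply[OF w])
  moreover have "?W x = ?Z (z *\<^sub>C ?W x - A (?W x))" by (simp add: resolvent_apply[OF z])
  moreover have "?Z (w *\<^sub>C ?W x - z *\<^sub>C ?W x)
      = ?Z (w *\<^sub>C ?W x - A (?W x)) - ?Z (z *\<^sub>C ?W x - A (?W x))"
    by (simp flip: blinfun.diff_right)
  ultimately have "?Z x - ?W x = ?Z (w *\<^sub>C ?W x - z *\<^sub>C ?W x)" by simp
  then show ?thesis
    by (simp add: complex_linearD[OF Z] flip: complex_vector.scale_left_diff_distrib)
qed

section \<open>Holomorphy of the resolvent and its contour integrals\<close>

text \<open>The radius depends only on a bound for the resolvent at the centre, so it is uniform along a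
  compact contour.\<close>

lemma resolvent_near:
  fixes A :: "'h::complex_hilbert_space \<Rightarrow>\<^sub>L 'h"
  assumes c: "c \<in> resolvent_set A" and K: "norm (resolvent A c) \<le> K" and z: "K * cmod (z - c) \<le> 1 / 2"
  shows "z \<in> resolvent_set A" and "norm (resolvent A z) \<le> 2 * K"
    and "norm (resolvent A z - resolvent A c) \<le> 2 * K\<^sup>2 * cmod (z - c)"
proof -
  have K0: "0 \<le> K" using K norm_ge_zero order_trans by blast
  define D :: "'h \<Rightarrow>\<^sub>L 'h" where "D = scale_op (c - z) id_blinfun"
  have nD: "norm D \<le> cmod (z - c)"
    using norm_scale_op_le[of "c - z" "id_blinfun :: 'h \<Rightarrow>\<^sub>L 'h"] norm_blinfun_id_le[where 'a = 'h]
      mult_left_mono[OF norm_blinfun_id_le[where 'a = 'h], of "cmod (c - z)"]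
    by (simp add: D_def norm_minus_commute)
  have eq: "scale_op z id_blinfun - A = (scale_op c id_blinfun - A) - D"
    by (simp add: D_def scale_op.diff_left)
  have "K * norm D \<le> 1 / 2"
    using mult_left_mono[OF nD K0] z by linarith
  then obtain Z where Z: "inverse_ops (scale_op z id_blinfun - A) Z" "norm Z \<le> 2 * K"
    using inverse_ops_perturb[OF resolvent_inverse[OF c] K] eq by metis
  then show "z \<in> resolvent_set A" using resolvent_set_iff by blast
  have RZ: "resolvent A z = Z" by (rule resolvent_eqI[OF Z(1)])
  show "norm (resolvent A z) \<le> 2 * K" using RZ Z(2) by simp
  have "norm (Z - resolvent A c) \<le> norm Z * norm D * norm (resolvent A c)"
    using norm_inverse_ops_diff[OF resolvent_inverse[OF c]] Z(1) eq by metis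
  also have "\<dots> \<le> (2 * K) * cmod (z - c) * K"
    using Z(2) nD K K0 by (intro mult_mono) auto
  finally show "norm (resolvent A z - resolvent A c) \<le> 2 * K\<^sup>2 * cmod (z - c)"
    by (simp add: RZ power2_eq_square ac_simps)
qed

lemma resolvent_ball:
  fixes A :: "'h::complex_hilbert_space \<Rightarrow>\<^sub>L 'h"
  assumes c: "c \<in> resolvent_set A"
  obtains r where "r > 0" "ball c r \<subseteq> resolvent_set A"
    "\<And>z. z \<in> ball c r \<Longrightarrow> norm (resolvent A z - resolvent A c) \<le> 2 * (norm (resolvent A c) + 1)\<^sup>2 * cmod (z - c)"
proof -
  define K where "K = norm (resolvent A c) + 1"
  have K: "K > 0" "norm (resolvent A c) \<le> K" by (simp_all add: K_def add_nonneg_pos)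
  have "K * cmod (z - c) \<le> 1 / 2" if "z \<in> ball c (1 / (2 * K))" for z
    using that K(1) by (simp add: dist_norm norm_minus_commute field_simps)
  then show thesis
    using K(1) resolvent_near[OF c K(2)]
    by (intro that[of "1 / (2 * K)"]) (auto simp: K_def)
qed

lemma open_resolvent_set: "open (resolvent_set A)"
  by (meson open_contains_ball resolvent_ball)

lemma isCont_resolvent:
  assumes c: "c \<in> resolvent_set A"
  shows "isCont (resolvent A) c"
proof -
  obtain r where r: "r > 0"
    "\<And>z. z \<in> ball c r \<Longrightarrow> norm (resolvent A z - resolvent A c) \<le> 2 * (norm (resolvent A c) + 1)\<^sup>2 * cmod (z - c)"
    using resolvent_ball[OF c] by metis
  have "((\<lambda>z. 2 * (norm (resolvent A c) + 1)\<^sup>2 * cmod (z - c)) \<longlongrightarrow> 2 * (norm (resolvent A c) + 1)\<^sup>2 * cmod (c - c)) (at c)"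
    by (intro tendsto_intros)
  then have lim: "((\<lambda>z. 2 * (norm (resolvent A c) + 1)\<^sup>2 * cmod (z - c)) \<longlongrightarrow> 0) (at c)" by simp
  have "((\<lambda>z. resolvent A z - resolvent A c) \<longlongrightarrow> 0) (at c)"
  proof (rule Lim_null_comparison[OF _ lim])
    show "\<forall>\<^sub>F z in at c. norm (resolvent A z - resolvent A c) \<le> 2 * (norm (resolvent A c) + 1)\<^sup>2 * cmod (z - c)"
      using r unfolding eventually_at by (metis mem_ball dist_commute)
  qed
  then show ?thesis
    by (simp add: isCont_def LIM_zero_iff)
qed

lemma continuous_on_resolvent: "continuous_on (resolvent_set A) (resolvent A)"
  by (simp add: continuous_at_imp_continuous_on isCont_resolvent)

text \<open>The first resolvent identity turns the difference quotient into \<open>- R(z) R(c)\<close>, and \<open>R\<close> is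
  continuous.\<close>

lemma has_derivative_resolvent:
  assumes A: "complex_linear A" and c: "c \<in> resolvent_set A"
  shows "(resolvent A has_derivative (\<lambda>h. - scale_op h (resolvent A c o\<^sub>L resolvent A c))) (at c)"
proof -
  obtain r where r: "r > 0" "ball c r \<subseteq> resolvent_set A"
    using resolvent_ball[OF c] by metis
  define H where "H z = norm (resolvent A z - resolvent A c) * norm (resolvent A c)" for z
  show ?thesis
  proof (rule has_derivativeI_sandwich[of r _ _ _ _ H])
    show "r > 0" by fact
    show "bounded_linear (\<lambda>h. - scale_op h (resolvent A c o\<^sub>L resolvent A c))"
      by (intro bounded_linear_minus scale_op.bounded_linear_left)
    have "isCont H c"
      unfolding H_def by (intro continuous_intros isCont_resolvent[OF c])
    then show "(H \<longlongrightarrow> 0) (at c)"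
      unfolding isCont_def by (simp add: H_def)
    fix z assume zc: "z \<noteq> c" and "dist z c < r"
    then have z: "z \<in> resolvent_set A" using r by (auto simp: dist_commute)
    have "resolvent A z - resolvent A c - - scale_op (z - c) (resolvent A c o\<^sub>L resolvent A c)
        = scale_op (c - z) ((resolvent A z - resolvent A c) o\<^sub>L resolvent A c)"
    proof -
      have "resolvent A z - resolvent A c = scale_op (c - z) (resolvent A z o\<^sub>L resolvent A c)"
        by (rule blinfun_eqI) (simp add: blinfun.diff_left resolvent_identity[OF A z c])
      moreover have "- scale_op (z - c) X = scale_op (c - z) X" for X :: "'a \<Rightarrow>\<^sub>L 'a"
        by (simp flip: scale_op.minus_left)
      ultimately show ?thesis
        unfolding bounded_bilinear.diff_left[OF bounded_bilinear_blinfun_compose] scale_op.diff_right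
        by simp
    qed
    then have "norm (resolvent A z - resolvent A c - - scale_op (z - c) (resolvent A c o\<^sub>L resolvent A c))
        \<le> cmod (z - c) * H z"
      using norm_scale_op_le[of "c - z" "(resolvent A z - resolvent A c) o\<^sub>L resolvent A c"]
        mult_left_mono[OF norm_blinfun_compose[of "resolvent A z - resolvent A c" "resolvent A c"], of "cmod (c - z)"]
      by (simp add: H_def norm_minus_commute)
    then show "norm (resolvent A z - resolvent A c - - scale_op (z - c) (resolvent A c o\<^sub>L resolvent A c))
        / norm (z - c) \<le> H z"
      using zc by (simp add: divide_le_eq mult.commute)
  qed
qed

text \<open>Composed with such a functional, the resolvent becomes a scalar holomorphic function, to which
  Cauchy's theorem applies; the matrix elements among these functionals separate operators.\<close>

definition complex_functional :: "(('h::complex_hilbert_space \<Rightarrow>\<^sub>L 'h) \<Rightarrow> complex) \<Rightarrow> bool" where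
  "complex_functional \<phi> \<longleftrightarrow> bounded_linear \<phi> \<and> (\<forall>c A. \<phi> (scale_op c A) = c * \<phi> A)"

lemma holomorphic_on_functional_resolvent:
  assumes A: "complex_linear A" and \<phi>: "complex_functional \<phi>"
  shows "(\<lambda>z. \<phi> (resolvent A z)) holomorphic_on resolvent_set A"
proof -
  interpret bounded_linear \<phi> using \<phi> by (simp add: complex_functional_def)
  have sc: "\<phi> (scale_op c B) = c * \<phi> B" for c B using \<phi> by (simp add: complex_functional_def)
  have "((\<lambda>z. \<phi> (resolvent A z)) has_field_derivative - \<phi> (resolvent A c o\<^sub>L resolvent A c)) (at c)"
    if "c \<in> resolvent_set A" for c
  proof -
    have "(*) (- q) = (\<lambda>h. - (h * q))" for q :: complex by (auto simp: fun_eq_iff)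
    then show ?thesis
      using has_derivative[OF has_derivative_resolvent[OF A that]]
      by (simp add: has_field_derivative_def linear_neg[OF linear_axioms] sc)
  qed
  then show ?thesis
    using holomorphic_on_open[OF open_resolvent_set] by blast
qed

text \<open>A primitive of the resolvent near \<open>c\<close> is its integral along the segment from \<open>c\<close>.
  Differentiating under the integral sign leaves \<open>d/dt [t R(c + t (z - c))]\<close> under it, because
  \<open>R' = - R\<^sup>2\<close>.\<close>

lemma resolvent_local_primitive:
  fixes A :: "'h::complex_hilbert_space \<Rightarrow>\<^sub>L 'h"
  assumes A: "complex_linear A" and c: "c \<in> resolvent_set A"
  obtains r G where "r > 0" "ball c r \<subseteq> resolvent_set A"
    "\<And>z. z \<in> ball c r \<Longrightarrow> (G has_derivative (\<lambda>h. scale_op h (resolvent A z))) (at z)"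
proof -
  obtain r where r: "r > 0" "ball c r \<subseteq> resolvent_set A"
    using resolvent_ball[OF c] by metis
  define w where "w z t = c + of_real t * (z - c)" for z and t :: real
  define Q where "Q z t = resolvent A (w z t)
      - scale_op (of_real t * (z - c)) (resolvent A (w z t) o\<^sub>L resolvent A (w z t))" for z t
  have w_ball: "w z t \<in> ball c r" if "z \<in> ball c r" "t \<in> {0..1}" for z t
  proof -
    have "t * cmod (z - c) \<le> 1 * cmod (z - c)"
      using that(2) by (intro mult_right_mono) auto
    then show ?thesis
      using that by (simp add: w_def dist_norm norm_mult norm_minus_commute)
  qed
  then have w_res: "w z t \<in> resolvent_set A" if "z \<in> ball c r" "t \<in> {0..1}" for z t
    using that r by blast
  have cont_R: "continuous_on (ball c r \<times> {0..1}) (\<lambda>x. resolvent A (w (fst x) (snd x)))"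
    by (rule continuous_on_compose2[OF continuous_on_resolvent])
      (auto simp: w_def intro!: continuous_intros w_res[unfolded w_def])
  have cont_Q: "continuous_on (ball c r \<times> {0..1}) (\<lambda>x. Q (fst x) (snd x))"
    unfolding Q_def
    by (intro continuous_intros scale_op.continuous_on cont_R)
  define G where "G z = integral (cbox 0 1) (\<lambda>t. scale_op (z - c) (resolvent A (w z t)))" for z
  have "(G has_derivative (\<lambda>h. scale_op h (resolvent A z))) (at z)" if z: "z \<in> ball c r" for z
  proof -
    have cont_z: "continuous_on {0..1} (\<lambda>t. resolvent A (w x t))" if "x \<in> ball c r" for x
    proof -
      have "continuous_on {0..1} (\<lambda>t::real. (x, t))" by (intro continuous_intros)
      moreover have "(\<lambda>t. (x, t)) ` {0..1} \<subseteq> ball c r \<times> {0..1}" using that by auto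
      ultimately show ?thesis
        using continuous_on_compose2[OF cont_R, of "{0..1}" "\<lambda>t. (x, t)"] by simp
    qed
    have "(G has_derivative integral (cbox 0 1) (\<lambda>t. scale_op.prod_left (Q z t))) (at z within ball c r)"
      unfolding G_def
    proof (rule leibniz_rule)
      show "z \<in> ball c r" by fact
      show "convex (ball c r)" by simp
      show "(\<lambda>t. scale_op (x - c) (resolvent A (w x t))) integrable_on cbox 0 1" if "x \<in> ball c r" for x
        by (rule integrable_continuous)
          (use cont_z[OF that] in \<open>auto intro!: scale_op.continuous_on continuous_intros\<close>)
      show "continuous_on (ball c r \<times> cbox 0 1) (\<lambda>(x, t). scale_op.prod_left (Q x t))"
        using bounded_linear.continuous_on[OF scale_op.bounded_linear_prod_left cont_Q]
        by (simp add: case_prod_beta)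
      fix x and t :: real assume x: "x \<in> ball c r" and t: "t \<in> cbox 0 1"
      have "((\<lambda>x. w x t) has_derivative (\<lambda>h. of_real t * h)) (at x within ball c r)"
        unfolding w_def by (auto intro!: derivative_eq_intros)
      moreover have "(resolvent A has_derivative (\<lambda>h. - scale_op h (resolvent A (w x t) o\<^sub>L resolvent A (w x t)))) (at (w x t))"
        using has_derivative_resolvent[OF A w_res[OF x]] t by simp
      ultimately have R: "((\<lambda>x. resolvent A (w x t)) has_derivative
          (\<lambda>h. - scale_op (of_real t * h) (resolvent A (w x t) o\<^sub>L resolvent A (w x t)))) (at x within ball c r)"
        by (rule has_derivative_compose)
      have "((\<lambda>x. scale_op (x - c) (resolvent A (w x t))) has_derivative
          (\<lambda>h. scale_op (x - c) (- scale_op (of_real t * h) (resolvent A (w x t) o\<^sub>L resolvent A (w x t)))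
             + scale_op (h - 0) (resolvent A (w x t)))) (at x within ball c r)"
        by (rule scale_op.FDERIV[OF _ R]) (intro derivative_intros)
      moreover have "scale_op (x - c) (- scale_op (of_real t * h) (resolvent A (w x t) o\<^sub>L resolvent A (w x t)))
             + scale_op (h - 0) (resolvent A (w x t)) = scale_op h (Q x t)" for h
        by (simp add: Q_def scale_op.minus_right scale_op.diff_right scale_op_scale_op ac_simps)
      ultimately show "((\<lambda>x. scale_op (x - c) (resolvent A (w x t))) has_derivative
          blinfun_apply (scale_op.prod_left (Q x t))) (at x within ball c r)"
        by (simp add: scale_op.prod_left.rep_eq)
    qed
    moreover have "((\<lambda>t. Q z t) has_integral (1 *\<^sub>R resolvent A (w z 1) - 0 *\<^sub>R resolvent A (w z 0))) {0..1}"
    proof (rule fundamental_theorem_of_calculus)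
      fix t :: real assume t: "t \<in> {0..1}"
      have "((\<lambda>t. w z t) has_derivative (\<lambda>h. of_real h * (z - c))) (at t within {0..1})"
        unfolding w_def by (auto intro!: derivative_eq_intros)
      then have "((\<lambda>t. resolvent A (w z t)) has_derivative
          (\<lambda>h. - scale_op (of_real h * (z - c)) (resolvent A (w z t) o\<^sub>L resolvent A (w z t)))) (at t within {0..1})"
        by (rule has_derivative_compose) (rule has_derivative_resolvent[OF A w_res[OF z t]])
      then have "((\<lambda>t. t *\<^sub>R resolvent A (w z t)) has_derivative
          (\<lambda>h. t *\<^sub>R (- scale_op (of_real h * (z - c)) (resolvent A (w z t) o\<^sub>L resolvent A (w z t)))
             + h *\<^sub>R resolvent A (w z t))) (at t within {0..1})"
        by (intro has_derivative_scaleR has_derivative_ident)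
      moreover have "t *\<^sub>R (- scale_op (of_real h * (z - c)) (resolvent A (w z t) o\<^sub>L resolvent A (w z t)))
             + h *\<^sub>R resolvent A (w z t) = h *\<^sub>R Q z t" for h
        unfolding Q_def scaleR_conv_of_real[symmetric] scale_op.scaleR_left
        by (simp add: scaleR_right_diff_distrib)
      ultimately show "((\<lambda>t. t *\<^sub>R resolvent A (w z t)) has_vector_derivative Q z t) (at t within {0..1})"
        by (simp add: has_vector_derivative_def)
    qed simp
    then have "(Q z has_integral resolvent A z) (cbox 0 1)" by (simp add: w_def)
    then have "((scale_op.prod_left \<circ> Q z) has_integral scale_op.prod_left (resolvent A z)) (cbox 0 1)"
      by (rule has_integral_linear[OF _ scale_op.bounded_linear_prod_left])
    then have "integral (cbox 0 1) (\<lambda>t. scale_op.prod_left (Q z t)) = scale_op.prod_left (resolvent A z)"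
      by (simp add: o_def integral_unique)
    ultimately have "(G has_derivative blinfun_apply (scale_op.prod_left (resolvent A z))) (at z within ball c r)"
      by simp
    then show ?thesis
      using z by (simp add: at_within_open[OF z open_ball] scale_op.prod_left.rep_eq)
  qed
  with r show thesis by (rule that)
qed

text \<open>Near an exceptional parameter \<open>\<gamma>'\<close> may be unbounded, and the integrand with it.  It is
  nevertheless the derivative of \<open>G \<circ> \<gamma>\<close> for a local primitive \<open>G\<close>, and the gauge integral integrates
  derivatives with finitely many exceptions.\<close>

lemma integrable_resolvent_along_path:
  fixes A :: "'h::complex_hilbert_space \<Rightarrow>\<^sub>L 'h"
  assumes A: "complex_linear A" and \<gamma>: "valid_path \<gamma>" and im: "path_image \<gamma> \<subseteq> resolvent_set A"
  shows "(\<lambda>s. scale_op (vector_derivative \<gamma> (at s within {0..1})) (resolvent A (\<gamma> s))) integrable_on {0..1}"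
    (is "?f integrable_on _")
proof -
  obtain S where cont: "continuous_on {0..1} \<gamma>" and S: "finite S" "\<gamma> C1_differentiable_on ({0..1} - S)"
    using \<gamma> by (auto simp: valid_path_def piecewise_C1_differentiable_on_def)
  have "?f integrable_on cbox 0 1"
  proof (rule integrable_on_little_subintervals, rule ballI)
    fix x :: real assume x: "x \<in> cbox 0 1"
    then have "\<gamma> x \<in> resolvent_set A" using im by (auto simp: path_image_def)
    then obtain r G where r: "r > 0" and G: "\<And>z. z \<in> ball (\<gamma> x) r \<Longrightarrow>
        (G has_derivative (\<lambda>h. scale_op h (resolvent A z))) (at z)"
      using resolvent_local_primitive[OF A] by metis
    have "\<exists>d>0. \<forall>s\<in>{0..1}. dist s x < d \<longrightarrow> dist (\<gamma> s) (\<gamma> x) < r"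
      using cont[unfolded continuous_on_iff, rule_format, of x r] x r by simp
    then obtain d where d: "d > 0" "\<And>s. s \<in> {0..1} \<Longrightarrow> dist s x < d \<Longrightarrow> dist (\<gamma> s) (\<gamma> x) < r"
      by blast
    show "\<exists>d>0. \<forall>u v. x \<in> cbox u v \<and> cbox u v \<subseteq> ball x d \<and> cbox u v \<subseteq> cbox 0 1 \<longrightarrow> ?f integrable_on cbox u v"
    proof (intro exI conjI allI impI, rule d(1), elim conjE)
      fix u v assume xuv: "x \<in> cbox u v" and uv_d: "cbox u v \<subseteq> ball x d" and uv: "cbox u v \<subseteq> cbox 0 1"
      have "u \<le> v" using xuv by simp
      then have u0: "0 \<le> u" and v1: "v \<le> 1" using uv by simp_all
      have in_ball: "\<gamma> s \<in> ball (\<gamma> x) r" if "s \<in> {u..v}" for s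
      proof -
        have "s \<in> ball x d" using that uv_d by (metis cbox_interval subsetD)
        then show ?thesis
          using that d(2)[of s] u0 v1 by (simp add: dist_commute)
      qed
      have "(?f has_integral (G (\<gamma> v) - G (\<gamma> u))) {u..v}"
      proof (rule fundamental_theorem_of_calculus_interior_strong[OF S(1)])
        show "u \<le> v" by fact
        have "continuous_on (ball (\<gamma> x) r) G"
          using G by (meson continuous_at_imp_continuous_on has_derivative_continuous)
        then show "continuous_on {u..v} (\<lambda>s. G (\<gamma> s))"
          by (rule continuous_on_compose2) (use continuous_on_subset[OF cont, of "{u..v}"] u0 v1 in_ball in auto)
        fix s assume s: "s \<in> {u<..<v} - S"
        then have "s \<in> {0<..<1}"
          using u0 v1 by simp
        then have "at s within {0..1} = at s" by (intro at_within_interior) simp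
        moreover have "(\<gamma> has_vector_derivative vector_derivative \<gamma> (at s)) (at s)"
        proof -
          have "s \<in> {0..1} - S" using s \<open>s \<in> {0<..<1}\<close> by simp
          then have "\<gamma> differentiable at s"
            using S(2) unfolding C1_differentiable_on_eq by blast
          then show ?thesis by (simp only: vector_derivative_works)
        qed
        ultimately have "(\<gamma> has_derivative (\<lambda>h. h *\<^sub>R vector_derivative \<gamma> (at s within {0..1}))) (at s)"
          by (simp add: has_vector_derivative_def)
        then have "((\<lambda>s. G (\<gamma> s)) has_derivative
            (\<lambda>h. scale_op (h *\<^sub>R vector_derivative \<gamma> (at s within {0..1})) (resolvent A (\<gamma> s)))) (at s)"
          by (rule has_derivative_compose) (rule G, rule in_ball, use s in simp)
        then show "((\<lambda>s. G (\<gamma> s)) has_vector_derivative ?f s) (at s)"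
          by (simp add: has_vector_derivative_def scale_op.scaleR_left)
      qed
      then show "?f integrable_on cbox u v" by auto
    qed
  qed
  then show ?thesis by simp
qed

lemma functional_riesz_projection:
  fixes A :: "'h::complex_hilbert_space \<Rightarrow>\<^sub>L 'h"
  assumes A: "complex_linear A" and \<gamma>: "valid_path \<gamma>" and im: "path_image \<gamma> \<subseteq> resolvent_set A"
    and \<phi>: "complex_functional \<phi>"
  shows "\<phi> (riesz_projection \<gamma> A) = 1 / (2 * of_real pi * \<i>) * contour_integral \<gamma> (\<lambda>z. \<phi> (resolvent A z))"
proof -
  let ?f = "\<lambda>s. scale_op (vector_derivative \<gamma> (at s within {0..1})) (resolvent A (\<gamma> s))"
  have bl: "bounded_linear \<phi>" and sc: "\<And>c B. \<phi> (scale_op c B) = c * \<phi> B"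
    using \<phi> by (auto simp: complex_functional_def)
  have "((\<phi> \<circ> ?f) has_integral \<phi> (integral {0..1} ?f)) {0..1}"
    by (rule has_integral_linear[OF integrable_integral bl])
      (rule integrable_resolvent_along_path[OF A \<gamma> im])
  then have "((\<lambda>z. \<phi> (resolvent A z)) has_contour_integral \<phi> (integral {0..1} ?f)) \<gamma>"
    by (simp add: has_contour_integral_def o_def sc mult.commute)
  then show ?thesis
    by (simp add: riesz_projection_def sc contour_integral_unique)
qed

section \<open>Riesz projections\<close>

lemma complex_functional_cinner: "complex_functional (\<lambda>B. cinner x (blinfun_apply B y))"
  unfolding complex_functional_def
  by (auto simp: cinner_scaleC_right
      intro!: bounded_linear_compose[OF bounded_linear_cinner_right bounded_linear_apply_blinfun])

lemma complex_functional_cinner_compose: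
  assumes "complex_linear T"
  shows "complex_functional (\<lambda>B. cinner x (blinfun_apply T (blinfun_apply B y)))"
  unfolding complex_functional_def
  by (auto simp: cinner_scaleC_right complex_linearD[OF assms]
      intro!: bounded_linear_compose[OF bounded_linear_cinner_right]
        bounded_linear_compose[OF blinfun.bounded_linear_right bounded_linear_apply_blinfun])

lemma complex_functional_diff:
  "complex_functional \<phi> \<Longrightarrow> complex_functional \<psi> \<Longrightarrow> complex_functional (\<lambda>B. \<phi> B - \<psi> B)"
  by (simp add: complex_functional_def bounded_linear_sub right_diff_distrib)

lemma complex_functional_cmult:
  "complex_functional \<phi> \<Longrightarrow> complex_functional (\<lambda>B. c * \<phi> B)"
  by (simp add: complex_functional_def bounded_linear_const_mult)

text \<open>\<open>P\<close> stands for a Riesz projection whose contour has been replaced by a nearby polynomial loop.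
  Such a loop may cross itself, so the winding numbers take over the role of its inside; its
  derivative is bounded, as is needed to differentiate Cauchy transforms.\<close>

locale contour_projection =
  fixes A P :: "'h::complex_hilbert_space \<Rightarrow>\<^sub>L 'h" and p :: "real \<Rightarrow> complex"
  assumes linA: "complex_linear A"
    and poly: "polynomial_function p"
    and loop: "pathfinish p = pathstart p"
    and image: "path_image p \<subseteq> resolvent_set A"
    and winding: "\<And>w. w \<notin> resolvent_set A \<Longrightarrow> winding_number p w \<in> {0, 1}"
    and functional: "\<And>\<phi>. complex_functional \<phi> \<Longrightarrow>
      \<phi> P = 1 / (2 * of_real pi * \<i>) * contour_integral p (\<lambda>z. \<phi> (resolvent A z))"
begin

lemma valid: "valid_path p"
  by (rule valid_path_polynomial_function[OF poly])

lemma functional_eq_0: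
  assumes "complex_functional \<phi>" "\<And>z. z \<in> path_image p \<Longrightarrow> \<phi> (resolvent A z) = 0"
  shows "\<phi> P = 0"
  using functional[OF assms(1)] contour_integral_eq[of p "\<lambda>z. \<phi> (resolvent A z)" "\<lambda>_. 0"] assms(2)
  by simp

lemma complex_linear_P: "complex_linear P"
  unfolding complex_linear_def
proof (intro allI)
  fix c y
  have "cinner x (P (c *\<^sub>C y)) - c * cinner x (P y) = 0" for x
    by (rule functional_eq_0)
      (use image in \<open>auto intro!: complex_functional_diff complex_functional_cmult complex_functional_cinner
        simp: complex_linearD[OF complex_linear_resolvent[OF linA]] cinner_scaleC_right\<close>)
  then show "P (c *\<^sub>C y) = c *\<^sub>C P y"
    by (intro cinner_ext) (simp add: cinner_scaleC_right)
qed

lemma P_commute: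
  assumes T: "complex_linear T"
    and comm: "\<And>z x. z \<in> path_image p \<Longrightarrow>
      blinfun_apply (resolvent A z) (blinfun_apply T x) = blinfun_apply T (blinfun_apply (resolvent A z) x)"
  shows "blinfun_apply P (blinfun_apply T y) = blinfun_apply T (blinfun_apply P y)"
proof -
  have "cinner x (P (T y)) - cinner x (T (P y)) = 0" for x
    by (rule functional_eq_0)
      (auto intro!: complex_functional_diff complex_functional_cinner complex_functional_cinner_compose T
        simp: comm)
  then show ?thesis by (intro cinner_ext) simp
qed

lemma P_commute_A: "blinfun_apply P (blinfun_apply A y) = blinfun_apply A (blinfun_apply P y)"
  using image by (intro P_commute linA resolvent_commute) auto

lemma resolvents_commute:
  assumes z: "z \<in> resolvent_set A" and w: "w \<in> resolvent_set A"
  shows "blinfun_apply (resolvent A z) (blinfun_apply (resolvent A w) x)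
    = blinfun_apply (resolvent A w) (blinfun_apply (resolvent A z) x)"
proof (cases "z = w")
  case False
  let ?Z = "resolvent A z" and ?W = "resolvent A w"
  have "(w - z) *\<^sub>C ?Z (?W x) = - ((z - w) *\<^sub>C ?W (?Z x))"
    using resolvent_identity[OF linA z w, of x] resolvent_identity[OF linA w z, of x]
    by (metis minus_diff_eq)
  also have "\<dots> = (w - z) *\<^sub>C ?W (?Z x)"
    by (simp flip: complex_vector.scale_minus_left)
  finally show ?thesis
    using False by (simp add: complex_vector.scale_cancel_left)
qed simp

lemma P_commute_resolvent:
  assumes "z \<in> resolvent_set A"
  shows "blinfun_apply P (blinfun_apply (resolvent A z) y) = blinfun_apply (resolvent A z) (blinfun_apply P y)"
  using image by (intro P_commute complex_linear_resolvent[OF linA assms] resolvents_commute assms) auto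

definition cauchy_transform :: "'h \<Rightarrow> 'h \<Rightarrow> complex \<Rightarrow> complex" where
  "cauchy_transform x y z =
     contour_integral p (\<lambda>\<zeta>. cinner x (blinfun_apply (resolvent A \<zeta>) y) / (\<zeta> - z)) / (2 * of_real pi * \<i>)"

lemma holomorphic_matrix_element:
  "(\<lambda>z. cinner x (blinfun_apply (resolvent A z) y)) holomorphic_on resolvent_set A"
  by (rule holomorphic_on_functional_resolvent[OF linA complex_functional_cinner])

lemma holomorphic_cauchy_transform: "cauchy_transform x y holomorphic_on - path_image p"
proof -
  define g where "g = (\<lambda>\<zeta>. cinner x (blinfun_apply (resolvent A \<zeta>) y))"
  have g: "continuous_on (path_image p) g"
    unfolding g_def using holomorphic_matrix_element image holomorphic_on_imp_continuous_on
      continuous_on_subset by blast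
  obtain p' where p': "polynomial_function p'" "\<And>t. (p has_vector_derivative p' t) (at t)"
    using has_vector_derivative_polynomial_function[OF poly] by blast
  have "bounded (p' ` {0..1})"
    by (intro compact_imp_bounded compact_continuous_image continuous_on_polymonial_function p') auto
  then obtain B where "\<And>t. t \<in> {0..1} \<Longrightarrow> norm (p' t) \<le> B"
    unfolding bounded_iff by blast
  then have B: "norm (vector_derivative p (at t)) \<le> B" if "t \<in> {0..1}" for t
    using that vector_derivative_at[OF p'(2)] by metis
  define f where "f w = contour_integral p (\<lambda>u. g u / (u - w) ^ 1)" for w
  have int: "((\<lambda>u. g u / (u - w) ^ 1) has_contour_integral f w) p" if "w \<in> UNIV - path_image p" for w
  proof -
    have "(\<lambda>u. g u / (u - w)) holomorphic_on (resolvent_set A - {w})"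
      unfolding g_def
      by (intro holomorphic_intros holomorphic_on_subset[OF holomorphic_matrix_element]) auto
    then have "(\<lambda>u. g u / (u - w)) contour_integrable_on p"
      by (rule contour_integrable_holomorphic_simple)
        (use image that valid open_resolvent_set in \<open>auto intro: open_delete\<close>)
    then show ?thesis by (simp add: f_def has_contour_integral_integral)
  qed
  have "f field_differentiable at w" if "w \<in> UNIV - path_image p" for w
    using Cauchy_next_derivative(2)[OF g B int _ open_UNIV valid that]
    by (auto simp: field_differentiable_def)
  then have "f holomorphic_on - path_image p"
    by (auto simp: holomorphic_on_def intro: field_differentiable_at_within)
  then have "(\<lambda>z. f z / (2 * of_real pi * \<i>)) holomorphic_on - path_image p"
    by (intro holomorphic_intros) auto
  moreover have "cauchy_transform x y = (\<lambda>z. f z / (2 * of_real pi * \<i>))"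
    by (simp add: fun_eq_iff cauchy_transform_def f_def g_def)
  ultimately show ?thesis by simp
qed

text \<open>The resolvent identity under the integral sign: away from the contour, the part of the
  resolvent that \<open>P\<close> cuts off is its Cauchy transform, up to the winding number.\<close>

lemma cinner_P_resolvent:
  assumes z: "z \<in> resolvent_set A" and zp: "z \<notin> path_image p"
  shows "cinner x (blinfun_apply P (blinfun_apply (resolvent A z) y))
    = winding_number p z * cinner x (blinfun_apply (resolvent A z) y) - cauchy_transform x y z"
proof -
  let ?k = "1 / (2 * of_real pi * \<i>)"
  define g where "g = (\<lambda>\<zeta>. cinner x (blinfun_apply (resolvent A \<zeta>) y))"
  have int1: "(\<lambda>\<zeta>. g z * (1 / (\<zeta> - z))) contour_integrable_on p"
    by (intro contour_integrable_lmul contour_integrable_inversediff valid zp)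
  have "(\<lambda>u. g u / (u - z)) holomorphic_on (resolvent_set A - {z})"
    unfolding g_def
    by (intro holomorphic_intros holomorphic_on_subset[OF holomorphic_matrix_element]) auto
  then have int2: "(\<lambda>u. g u / (u - z)) contour_integrable_on p"
    by (rule contour_integrable_holomorphic_simple)
      (use image zp valid open_resolvent_set in \<open>auto intro: open_delete\<close>)
  have "cinner x (P (resolvent A z y))
      = ?k * contour_integral p (\<lambda>\<zeta>. cinner x (resolvent A \<zeta> (resolvent A z y)))"
    by (rule functional[OF complex_functional_cinner])
  also have "contour_integral p (\<lambda>\<zeta>. cinner x (resolvent A \<zeta> (resolvent A z y)))
      = contour_integral p (\<lambda>\<zeta>. g z * (1 / (\<zeta> - z)) - g \<zeta> / (\<zeta> - z))"
  proof (rule contour_integral_eq)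
    fix \<zeta> assume "\<zeta> \<in> path_image p"
    then have \<zeta>: "\<zeta> \<in> resolvent_set A" "\<zeta> \<noteq> z" using image zp by auto
    have "g \<zeta> - g z = (z - \<zeta>) * cinner x (resolvent A \<zeta> (resolvent A z y))"
      using resolvent_identity[OF linA \<zeta>(1) z, of y]
      by (simp add: g_def flip: cinner_diff_right cinner_scaleC_right)
    then have "g z - g \<zeta> = (\<zeta> - z) * cinner x (resolvent A \<zeta> (resolvent A z y))"
      by (metis minus_diff_eq minus_mult_left)
    then have "(g z - g \<zeta>) / (\<zeta> - z) = cinner x (resolvent A \<zeta> (resolvent A z y))"
      using \<zeta>(2) by simp
    then show "cinner x (resolvent A \<zeta> (resolvent A z y)) = g z * (1 / (\<zeta> - z)) - g \<zeta> / (\<zeta> - z)"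
      by (simp add: diff_divide_distrib)
  qed
  also have "\<dots> = g z * contour_integral p (\<lambda>\<zeta>. 1 / (\<zeta> - z)) - contour_integral p (\<lambda>\<zeta>. g \<zeta> / (\<zeta> - z))"
    by (simp only: contour_integral_diff[OF int1 int2]
        contour_integral_lmul[OF contour_integrable_inversediff[OF valid zp]])
  finally show ?thesis
    unfolding cauchy_transform_def winding_number_valid_path[OF valid zp] g_def[symmetric]
    by (simp add: g_def right_diff_distrib)
qed

text \<open>Inside the contour \<open>(I - P) R(z)\<close> agrees with a Cauchy transform and so continues
  holomorphically across the enclosed part of the spectrum.  Cauchy's theorem then annihilates its
  contour integral, which is \<open>P (I - P)\<close>; no second, nested contour is involved.\<close>

lemma P_idempotent: "blinfun_apply P (blinfun_apply P y) = blinfun_apply P y"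
proof -
  define y' where "y' = y - P y"
  have "cinner x (P y') = 0" for x
  proof -
    define h where "h = (\<lambda>z. cinner x (blinfun_apply (resolvent A z) y'))"
    define D where "D = {z. z \<notin> path_image p \<and> winding_number p z = 1}"
    define g where "g = (\<lambda>z. if z \<in> resolvent_set A then h z else cauchy_transform x y z)"
    have "open D"
      unfolding D_def by (rule open_winding_number_levelsets[OF valid_path_imp_path[OF valid] loop])
    have agree: "h z = cauchy_transform x y z" if "z \<in> resolvent_set A" "z \<in> D" for z
      using that cinner_P_resolvent[of z x y]
      by (simp add: h_def y'_def D_def blinfun.diff_right cinner_diff_right P_commute_resolvent)
    have "g holomorphic_on (resolvent_set A \<union> D)"
      unfolding g_def
    proof (rule holomorphic_on_If_Un)
      show "h holomorphic_on resolvent_set A"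
        unfolding h_def by (rule holomorphic_matrix_element)
      show "cauchy_transform x y holomorphic_on D"
        by (rule holomorphic_on_subset[OF holomorphic_cauchy_transform]) (auto simp: D_def)
    qed (use agree open_resolvent_set \<open>open D\<close> in auto)
    moreover have "winding_number p w = 0" if "w \<notin> resolvent_set A \<union> D" for w
      using that winding[of w] image by (auto simp: D_def)
    ultimately have "(g has_contour_integral 0) p"
      by (intro Cauchy_theorem_global[of "resolvent_set A \<union> D"])
        (use image valid loop open_resolvent_set \<open>open D\<close> in auto)
    moreover have "contour_integral p g = contour_integral p h"
      by (rule contour_integral_eq) (use image in \<open>auto simp: g_def\<close>)
    ultimately have "contour_integral p h = 0"
      by (simp add: contour_integral_unique)
    then show ?thesis
      using functional[OF complex_functional_cinner, of x y'] by (simp add: h_def)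
  qed
  then have "P y' = 0"
    by (intro cinner_ext) simp
  then show ?thesis by (simp add: y'_def blinfun.diff_right)
qed

lemma P_eq_0_if_no_spectrum:
  assumes "\<And>w. w \<notin> resolvent_set A \<Longrightarrow> winding_number p w = 0"
  shows "P = 0"
proof (rule blinfun_eqI, rule cinner_ext)
  fix x y
  have "((\<lambda>z. cinner x (blinfun_apply (resolvent A z) y)) has_contour_integral 0) p"
    by (rule Cauchy_theorem_global[OF open_resolvent_set holomorphic_matrix_element valid loop image assms])
  then show "cinner x (P y) = cinner x ((0 :: 'h \<Rightarrow>\<^sub>L 'h) y)"
    using functional[OF complex_functional_cinner, of x y] by (simp add: contour_integral_unique)
qed

end

lemma positive_contour_winding:
  assumes "positive_contour \<gamma>" "w \<notin> path_image \<gamma>"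
  shows "winding_number \<gamma> w = (if w \<in> inside (path_image \<gamma>) then 1 else 0)"
proof -
  have "w \<in> inside (path_image \<gamma>) \<or> w \<in> outside (path_image \<gamma>)"
    using assms(2) inside_Un_outside[of "path_image \<gamma>"] by blast
  then show ?thesis
    using assms(1) winding_number_zero_in_outside[of \<gamma> w]
    by (auto simp: positive_contour_def valid_path_imp_path)
qed

text \<open>The winding numbers about spectral points are integrals of functions holomorphic on the resolvent
  set, so they survive the passage to the polynomial loop.\<close>

lemma contour_projection_riesz:
  assumes A: "complex_linear A" and pos: "positive_contour \<gamma>" and im: "path_image \<gamma> \<subseteq> resolvent_set A"
  obtains p where "contour_projection A (riesz_projection \<gamma> A) p"
    "\<And>w. w \<notin> resolvent_set A \<Longrightarrow> winding_number p w = winding_number \<gamma> w"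
proof -
  have \<gamma>: "valid_path \<gamma>" "path \<gamma>" "pathfinish \<gamma> = pathstart \<gamma>"
    using pos by (auto simp: positive_contour_def valid_path_imp_path)
  obtain d where "0 < d \<and> (\<forall>g h. valid_path g \<and> valid_path h \<and>
      (\<forall>t\<in>{0..1}. norm (g t - \<gamma> t) < d \<and> norm (h t - \<gamma> t) < d) \<and>
      pathstart h = pathstart g \<and> pathfinish h = pathfinish g \<longrightarrow>
      path_image g \<subseteq> resolvent_set A \<and> path_image h \<subseteq> resolvent_set A \<and>
      (\<forall>f. f holomorphic_on resolvent_set A \<longrightarrow> contour_integral h f = contour_integral g f))"
    using contour_integral_nearby_ends[OF open_resolvent_set \<gamma>(2) im] by (rule exE)
  note d = this[THEN conjunct1] this[THEN conjunct2, THEN spec[of _ \<gamma>], THEN spec, THEN mp]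
  obtain p where p: "polynomial_function p" "pathstart p = pathstart \<gamma>" "pathfinish p = pathfinish \<gamma>"
      "\<And>t. t \<in> {0..1} \<Longrightarrow> norm (p t - \<gamma> t) < d"
    using path_approx_polynomial_function[OF \<gamma>(2) d(1)] by metis
  have vp: "valid_path p" by (rule valid_path_polynomial_function[OF p(1)])
  have "valid_path \<gamma> \<and> valid_path p \<and> (\<forall>t\<in>{0..1}. norm (\<gamma> t - \<gamma> t) < d \<and> norm (p t - \<gamma> t) < d) \<and>
      pathstart p = pathstart \<gamma> \<and> pathfinish p = pathfinish \<gamma>"
    using d(1) p(2-4) vp \<gamma>(1) by simp
  note near = d(2)[OF this]
  have imp: "path_image p \<subseteq> resolvent_set A" using near by blast
  have eq: "contour_integral p f = contour_integral \<gamma> f" if "f holomorphic_on resolvent_set A" for f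
    using near that by blast
  have wind: "winding_number p w = winding_number \<gamma> w" if w: "w \<notin> resolvent_set A" for w
  proof -
    have "(\<lambda>z. 1 / (z - w)) holomorphic_on resolvent_set A"
      using w by (intro holomorphic_intros) auto
    note same = eq[OF this]
    have wp: "w \<notin> path_image p" and w\<gamma>: "w \<notin> path_image \<gamma>" using w imp im by auto
    show ?thesis
      by (simp only: winding_number_valid_path[OF vp wp] winding_number_valid_path[OF \<gamma>(1) w\<gamma>] same)
  qed
  have "contour_projection A (riesz_projection \<gamma> A) p"
  proof
    show "pathfinish p = pathstart p" using p \<gamma> by simp
    show "winding_number p w \<in> {0, 1}" if "w \<notin> resolvent_set A" for w
    proof -
      have "w \<notin> path_image \<gamma>" using that im by blast
      then show ?thesis by (simp add: wind[OF that] positive_contour_winding[OF pos])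
    qed
    show "\<phi> (riesz_projection \<gamma> A) = 1 / (2 * of_real pi * \<i>) * contour_integral p (\<lambda>z. \<phi> (resolvent A z))"
      if "complex_functional \<phi>" for \<phi>
      using functional_riesz_projection[OF A \<gamma>(1) im that]
        eq[OF holomorphic_on_functional_resolvent[OF A that]] by (simp only:)
  qed (fact A p(1) imp)+
  then show thesis using wind by (rule that)
qed

text \<open>Without spectrum inside, the resolvent is holomorphic there and Cauchy's theorem makes the
  projection vanish.\<close>

lemma encloses_cluster_if_riesz_projection_nonzero:
  assumes A: "complex_linear A" and pos: "positive_contour \<gamma>" and im: "path_image \<gamma> \<subseteq> resolvent_set A"
    and nz: "riesz_projection \<gamma> A \<noteq> 0"
  shows "encloses_cluster \<gamma> A"
proof -
  obtain p where p: "contour_projection A (riesz_projection \<gamma> A) p"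
    "\<And>w. w \<notin> resolvent_set A \<Longrightarrow> winding_number p w = winding_number \<gamma> w"
    using contour_projection_riesz[OF A pos im] by blast
  then obtain w where w: "w \<notin> resolvent_set A" "winding_number \<gamma> w \<noteq> 0"
    using contour_projection.P_eq_0_if_no_spectrum[OF p(1)] nz by metis
  then have "w \<notin> path_image \<gamma>" using im by blast
  then have "w \<in> inside (path_image \<gamma>)"
    using w(2) positive_contour_winding[OF pos] by (cases "w \<in> inside (path_image \<gamma>)") simp_all
  then show ?thesis
    using w(1) im by (auto simp: encloses_cluster_def spectrum_def)
qed

lemma norm_blinfun_le_weak:
  fixes B :: "'h::complex_hilbert_space \<Rightarrow>\<^sub>L 'h"
  assumes "0 \<le> c" and weak: "\<And>x y. cmod (cinner x (blinfun_apply B y)) \<le> c * norm x * norm y"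
  shows "norm B \<le> c"
proof (rule norm_blinfun_bound[OF \<open>0 \<le> c\<close>])
  fix y
  have "cmod (cinner (B y) (B y)) = norm (B y) * norm (B y)"
    unfolding cinner_self norm_of_real by (simp add: power2_eq_square)
  then have "norm (B y) * norm (B y) \<le> (c * norm y) * norm (B y)"
    using weak[of "B y" y] by (simp add: ac_simps)
  then show "norm (B y) \<le> c * norm y"
    using \<open>0 \<le> c\<close> by (cases "B y = 0") simp_all
qed

lemma resolvent_bounded_near_path:
  assumes \<gamma>: "path \<gamma>" and im: "path_image \<gamma> \<subseteq> resolvent_set A"
  obtains N K where "open N" "path_image \<gamma> \<subseteq> N" "N \<subseteq> resolvent_set A" "K > 0"
    "\<And>z. z \<in> N \<Longrightarrow> norm (resolvent A z) \<le> K"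
proof -
  have "compact (resolvent A ` path_image \<gamma>)"
    by (intro compact_continuous_image compact_path_image \<gamma> continuous_on_subset[OF continuous_on_resolvent im])
  then obtain K where K: "K > 0" "\<And>z. z \<in> path_image \<gamma> \<Longrightarrow> norm (resolvent A z) \<le> K"
    using compact_imp_bounded bounded_pos by (metis imageI)
  define N where "N = (\<Union>c\<in>path_image \<gamma>. ball c (1 / (2 * K)))"
  have "z \<in> resolvent_set A \<and> norm (resolvent A z) \<le> 2 * K" if zN: "z \<in> N" for z
  proof -
    obtain c where c: "c \<in> path_image \<gamma>" and "z \<in> ball c (1 / (2 * K))"
      using zN unfolding N_def by (rule UN_E)
    then have "cmod (z - c) < 1 / (2 * K)" by (simp add: dist_norm norm_minus_commute)
    then have "K * cmod (z - c) \<le> 1 / 2" using K(1) by (simp add: field_simps)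
    then show ?thesis using resolvent_near(1,2)[OF subsetD[OF im c] K(2)[OF c]] by blast
  qed
  moreover have "path_image \<gamma> \<subseteq> N" using K(1) by (auto simp: N_def)
  ultimately show thesis
    using K(1) by (intro that[of N "2 * K"]) (auto, simp add: N_def open_UN)
qed

text \<open>A contour may fail to be rectifiable, so its length is not available for this estimate.  A bound
  for contour integrals of functions holomorphic \<^emph>\<open>near\<close> the contour takes its place, which is why
  the resolvents are compared on a neighbourhood.\<close>

lemma riesz_projection_perturbation:
  fixes A :: "'h::complex_hilbert_space \<Rightarrow>\<^sub>L 'h"
  assumes A: "complex_linear A" and \<gamma>: "valid_path \<gamma>" and im: "path_image \<gamma> \<subseteq> resolvent_set A"
  obtains e L where "e > 0" "L > 0"
    "\<And>T. complex_linear T \<Longrightarrow> norm (T - A) \<le> e \<Longrightarrow> path_image \<gamma> \<subseteq> resolvent_set T"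
    "\<And>T. complex_linear T \<Longrightarrow> norm (T - A) \<le> e \<Longrightarrow>
      norm (riesz_projection \<gamma> T - riesz_projection \<gamma> A) \<le> L * norm (T - A)"
proof -
  obtain N K where N: "open N" "path_image \<gamma> \<subseteq> N" "N \<subseteq> resolvent_set A" and K: "K > 0"
    and RK: "\<And>z. z \<in> N \<Longrightarrow> norm (resolvent A z) \<le> K"
    using resolvent_bounded_near_path[OF valid_path_imp_path[OF \<gamma>] im] by blast
  obtain l where l: "l > 0" and bound: "\<And>f B. f holomorphic_on N \<Longrightarrow> (\<And>z. z \<in> N \<Longrightarrow> cmod (f z) \<le> B) \<Longrightarrow>
      cmod (contour_integral \<gamma> f) \<le> l * B"
    using contour_integral_bound_exists[OF N(1) \<gamma> N(2)] by metis
  define k where "k = 1 / (2 * complex_of_real pi * \<i>)"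
  have k: "cmod k > 0" by (simp add: k_def)
  have near: "z \<in> resolvent_set T \<and> norm (resolvent T z - resolvent A z) \<le> 2 * K\<^sup>2 * norm (T - A)"
    if T: "norm (T - A) \<le> 1 / (2 * K)" and z: "z \<in> N" for T z
  proof -
    have zA: "z \<in> resolvent_set A" using z N by auto
    have eq: "scale_op z id_blinfun - T = (scale_op z id_blinfun - A) - (T - A)" by simp
    have "K * norm (T - A) \<le> 1 / 2"
      using T K by (simp add: field_simps)
    then obtain Z where Z: "inverse_ops (scale_op z id_blinfun - T) Z" "norm Z \<le> 2 * K"
      using inverse_ops_perturb[OF resolvent_inverse[OF zA] RK[OF z]] eq by metis
    have "norm (Z - resolvent A z) \<le> norm Z * norm (T - A) * norm (resolvent A z)"
      using norm_inverse_ops_diff[OF resolvent_inverse[OF zA]] Z(1) eq by metis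
    also have "\<dots> \<le> (2 * K) * norm (T - A) * K"
      using Z(2) RK[OF z] K by (intro mult_mono) auto
    finally show ?thesis
      using resolvent_eqI[OF Z(1)] Z(1) resolvent_set_iff by (auto simp: power2_eq_square ac_simps)
  qed
  have im_T: "path_image \<gamma> \<subseteq> resolvent_set T" if "norm (T - A) \<le> 1 / (2 * K)" for T
    using near[OF that] N by auto
  have est: "norm (riesz_projection \<gamma> T - riesz_projection \<gamma> A) \<le> (cmod k * l * (2 * K\<^sup>2)) * norm (T - A)"
    if linT: "complex_linear T" and T: "norm (T - A) \<le> 1 / (2 * K)" for T
  proof (rule norm_blinfun_le_weak)
    show "0 \<le> (cmod k * l * (2 * K\<^sup>2)) * norm (T - A)" using l by simp
    fix x y
    let ?f = "\<lambda>B :: 'h \<Rightarrow>\<^sub>L 'h. cinner x (B y)"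
    define g where "g = (\<lambda>z. ?f (resolvent T z) - ?f (resolvent A z))"
    have hT: "(\<lambda>z. ?f (resolvent T z)) holomorphic_on N"
      by (rule holomorphic_on_subset[OF holomorphic_on_functional_resolvent[OF linT complex_functional_cinner]])
        (use near[OF T] in auto)
    have hA: "(\<lambda>z. ?f (resolvent A z)) holomorphic_on N"
      by (rule holomorphic_on_subset[OF holomorphic_on_functional_resolvent[OF A complex_functional_cinner] N(3)])
    have "cmod (contour_integral \<gamma> g) \<le> l * (norm x * (2 * K\<^sup>2 * norm (T - A) * norm y))"
    proof (rule bound)
      show "g holomorphic_on N" unfolding g_def by (intro holomorphic_intros hT hA)
      fix z assume "z \<in> N"
      then have "norm ((resolvent T z - resolvent A z) y) \<le> 2 * K\<^sup>2 * norm (T - A) * norm y"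
        using near[OF T] by (meson norm_blinfun mult_right_mono norm_ge_zero order_trans)
      then have "norm x * norm ((resolvent T z - resolvent A z) y) \<le> norm x * (2 * K\<^sup>2 * norm (T - A) * norm y)"
        by (intro mult_left_mono) auto
      then show "cmod (g z) \<le> norm x * (2 * K\<^sup>2 * norm (T - A) * norm y)"
        using cinner_Cauchy_Schwarz[of x "(resolvent T z - resolvent A z) y"]
        by (simp add: g_def blinfun.diff_left cinner_diff_right)
    qed
    moreover have "?f (riesz_projection \<gamma> T - riesz_projection \<gamma> A) = k * contour_integral \<gamma> g"
    proof -
      have "contour_integral \<gamma> g = contour_integral \<gamma> (\<lambda>z. ?f (resolvent T z)) - contour_integral \<gamma> (\<lambda>z. ?f (resolvent A z))"
        unfolding g_def
        by (intro contour_integral_diff contour_integrable_holomorphic_simple[OF hT N(1) \<gamma> N(2)]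
            contour_integrable_holomorphic_simple[OF hA N(1) \<gamma> N(2)])
      then show ?thesis
        using functional_riesz_projection[OF linT \<gamma> im_T[OF T] complex_functional_cinner, of x y]
          functional_riesz_projection[OF A \<gamma> im complex_functional_cinner, of x y]
        by (simp add: k_def blinfun.diff_left cinner_diff_right diff_divide_distrib)
    qed
    ultimately show "cmod (?f (riesz_projection \<gamma> T - riesz_projection \<gamma> A))
        \<le> (cmod k * l * (2 * K\<^sup>2)) * norm (T - A) * norm x * norm y"
      using mult_left_mono[of "cmod (contour_integral \<gamma> g)" "l * (norm x * (2 * K\<^sup>2 * norm (T - A) * norm y))" "cmod k"]
      by (simp add: norm_mult ac_simps)
  qed
  show thesis
    by (rule that[of "1 / (2 * K)" "cmod k * l * (2 * K\<^sup>2)"]) (use K k l im_T est in auto)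
qed

section \<open>Pairs of close projections\<close>

locale close_projections =
  fixes P Q :: "'h::complex_hilbert_space \<Rightarrow>\<^sub>L 'h" and E :: "'h set"
  assumes linP: "complex_linear P" and linQ: "complex_linear Q"
    and idemP: "\<And>x. blinfun_apply P (blinfun_apply P x) = blinfun_apply P x"
    and idemQ: "\<And>x. blinfun_apply Q (blinfun_apply Q x) = blinfun_apply Q x"
    and E_def: "E = range (blinfun_apply Q)"
    and close: "norm (P - Q) \<le> 1 / 2"
begin

lemma in_E_iff: "x \<in> E \<longleftrightarrow> blinfun_apply Q x = x"
  unfolding E_def using idemQ by (metis rangeE rangeI)

lemma subspace_E: "complex_vector.subspace E"
  by (auto simp: complex_vector.subspace_def in_E_iff blinfun.add_right complex_linearD[OF linQ]
      blinfun.zero_right)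

lemma closed_E: "closed E"
proof -
  have "closed {x. blinfun_apply Q x = x}"
    by (intro closed_Collect_eq continuous_intros)
  then show ?thesis by (simp add: in_E_iff[symmetric])
qed

lemma norm_diff_apply: "norm (blinfun_apply P x - blinfun_apply Q x) \<le> norm (P - Q) * norm x"
  using norm_blinfun[of "P - Q" x] by (simp add: blinfun.diff_left)

lemma inj_on_E: "inj_on (blinfun_apply P) E"
proof (rule inj_onI)
  fix x y assume "x \<in> E" "y \<in> E" and eq: "blinfun_apply P x = blinfun_apply P y"
  then have "Q (x - y) = x - y" by (simp add: in_E_iff blinfun.diff_right)
  moreover have "P (x - y) = 0" using eq by (simp add: blinfun.diff_right)
  ultimately have "norm (x - y) \<le> norm (P - Q) * norm (x - y)"
    using norm_diff_apply[of "x - y"] by (simp add: norm_minus_commute)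
  also have "\<dots> \<le> 1 / 2 * norm (x - y)"
    by (intro mult_right_mono close) simp
  finally have "norm (x - y) \<le> 0" by linarith
  then show "x = y" by simp
qed

text \<open>\<open>I - (P - Q)\<close> is onto, and \<open>P\<close> turns it into \<open>P Q\<close>.\<close>

lemma image_E: "blinfun_apply P ` E = range (blinfun_apply P)"
proof -
  have "norm (P - Q) < 1" using close by linarith
  then obtain S where S: "inverse_ops (id_blinfun - (P - Q)) S"
    using id_minus_contraction_invertible by blast
  have "P y \<in> blinfun_apply P ` E" for y
  proof -
    have "P y = P ((id_blinfun - (P - Q)) (S y))"
      by (simp only: inverse_opsD[OF S])
    also have "\<dots> = P (Q (S y))"
      by (simp add: blinfun.diff_left blinfun.diff_right idemP)
    finally show ?thesis by (auto simp: E_def)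
  qed
  then show ?thesis by auto
qed

lemma U_apply: "x \<in> E \<Longrightarrow> U_map P E x = blinfun_apply P x"
  by (simp add: U_map_def)

lemma bij_U: "bij_betw (U_map P E) E (range (blinfun_apply P))"
  using inj_on_E image_E by (auto simp: bij_betw_def U_map_def inj_on_restrict_eq)

text \<open>The map \<open>U\<^sup>-\<^sup>1 P\<close>: the projection onto \<open>E\<close> with the same kernel as \<open>P\<close>.\<close>

definition lift :: "'h \<Rightarrow> 'h" where
  "lift z = inv_into E (U_map P E) (blinfun_apply P z)"

lemma lift_in_E: "lift z \<in> E"
  and P_lift: "blinfun_apply P (lift z) = blinfun_apply P z"
proof -
  have *: "P z \<in> U_map P E ` E"
    using bij_U by (simp add: bij_betw_def)
  show "lift z \<in> E"
    unfolding lift_def by (rule inv_into_into[OF *])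
  then show "P (lift z) = P z"
    using f_inv_into_f[OF *] U_apply unfolding lift_def by metis
qed

lemma lift_unique: "x \<in> E \<Longrightarrow> blinfun_apply P x = blinfun_apply P z \<Longrightarrow> lift z = x"
  using inj_on_E lift_in_E[of z] P_lift[of z] by (auto simp: inj_on_def)

lemma lift_add: "lift (x + y) = lift x + lift y"
  using complex_vector.subspace_add[OF subspace_E lift_in_E lift_in_E]
  by (intro lift_unique) (simp_all add: blinfun.add_right P_lift)

lemma lift_scaleC: "lift (c *\<^sub>C x) = c *\<^sub>C lift x"
  using complex_vector.subspace_scale[OF subspace_E lift_in_E]
  by (intro lift_unique) (simp_all add: complex_linearD[OF linP] P_lift)

text \<open>\<open>Q\<close> fixes \<open>lift z\<close> and \<open>P\<close> kills \<open>lift z - z\<close>, so \<open>lift z - Q z = (Q - P) (lift z - z)\<close>.\<close>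

lemma lift_minus_Q_le: "norm (lift z - blinfun_apply Q z) \<le> norm (P - Q) * norm (lift z - z)"
proof -
  have "lift z - Q z = - (P (lift z - z) - Q (lift z - z))"
    using lift_in_E[of z] by (simp add: in_E_iff blinfun.diff_right P_lift)
  then show ?thesis
    using norm_diff_apply[of "lift z - z"] by (simp add: norm_minus_commute)
qed

text \<open>The identity again: at distance at most \<open>1/2\<close> the term \<open>norm (lift z)\<close> on its right-hand side can
  be absorbed.\<close>

lemma norm_lift_le: "norm (lift z) \<le> (2 * norm Q + 1) * norm z"
proof -
  have "norm (lift z) \<le> norm (Q z) + norm (lift z - Q z)"
    by (metis add.commute diff_add_cancel norm_triangle_ineq)
  also have "norm (lift z - Q z) \<le> 1 / 2 * norm (lift z - z)"
    using lift_minus_Q_le[of z] mult_right_mono[OF close norm_ge_zero[of "lift z - z"]] by linarith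
  also have "norm (lift z - z) \<le> norm (lift z) + norm z"
    by (rule norm_triangle_ineq4)
  finally show ?thesis
    using norm_blinfun[of Q z] by (simp add: algebra_simps)
qed

lemma norm_lift_minus_Q_le: "norm (lift z - blinfun_apply Q z) \<le> norm (P - Q) * ((2 * norm Q + 2) * norm z)"
proof -
  have "norm (lift z - z) \<le> (2 * norm Q + 2) * norm z"
    using norm_triangle_ineq4[of "lift z" z] norm_lift_le[of z] by (simp add: algebra_simps)
  then show ?thesis
    using lift_minus_Q_le[of z] mult_left_mono norm_ge_zero order_trans by meson
qed

lemma V_eq: "V_map P E = hilbert_adjoint UNIV lift"
  by (simp add: V_map_def lift_def[abs_def])

lemma cinner_V: "cinner (V_map P E l) z = cinner l (lift z)"
  unfolding V_eq
  by (rule hilbert_adjoint_on(2)[where K = "2 * norm Q + 1"])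
    (auto simp: lift_add lift_scaleC norm_lift_le complex_vector.subspace_UNIV)

lemma norm_V_minus_adjoint_le:
  "norm (V_map P E l - hilbert_adjoint UNIV (blinfun_apply Q) l) \<le> norm (P - Q) * (2 * norm Q + 2) * norm l"
proof -
  let ?d = "V_map P E l - hilbert_adjoint UNIV (blinfun_apply Q) l"
  have Q: "cinner (hilbert_adjoint UNIV (blinfun_apply Q) l) z = cinner l (Q z)" for z
    by (rule hilbert_adjoint_on(2)[where K = "norm Q"])
      (auto simp: blinfun.add_right complex_linearD[OF linQ] norm_blinfun complex_vector.subspace_UNIV)
  have d: "cinner ?d z = cinner l (lift z - Q z)" for z
    by (simp add: cinner_diff_left cinner_V Q cinner_diff_right)
  have "norm ?d * norm ?d = cmod (cinner ?d ?d)"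
    unfolding cinner_self norm_of_real by (simp add: power2_eq_square)
  also have "cmod (cinner ?d ?d) \<le> norm l * (norm (P - Q) * ((2 * norm Q + 2) * norm ?d))"
    unfolding d using cinner_Cauchy_Schwarz[of l "lift ?d - Q ?d"]
      mult_left_mono[OF norm_lift_minus_Q_le[of ?d] norm_ge_zero[of l]] by linarith
  finally have "norm ?d * norm ?d \<le> (norm (P - Q) * (2 * norm Q + 2) * norm l) * norm ?d"
    by (simp add: ac_simps)
  then show ?thesis
    by (cases "norm ?d = 0") (simp_all add: mult_le_cancel_right)
qed

lemma range_P_finite_dim:
  assumes "finite S" "complex_vector.span S = E"
  shows "\<exists>S. finite S \<and> complex_vector.span S = range (blinfun_apply P)"
    and "complex_vector.dim (range (blinfun_apply P)) = complex_vector.dim E"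
proof -
  interpret vp: vector_space_pair "scaleC :: complex \<Rightarrow> 'h \<Rightarrow> 'h" "scaleC :: complex \<Rightarrow> 'h \<Rightarrow> 'h" ..
  interpret linear: Vector_Spaces.linear "scaleC :: complex \<Rightarrow> 'h \<Rightarrow> 'h" "scaleC :: complex \<Rightarrow> 'h \<Rightarrow> 'h" "blinfun_apply P"
    by unfold_locales (simp_all add: blinfun.add_right complex_linearD[OF linP])
  show "\<exists>S. finite S \<and> complex_vector.span S = range (blinfun_apply P)"
    using assms image_E by (intro exI[of _ "blinfun_apply P ` S"]) (simp add: linear.span_image)
  obtain B where B: "B \<subseteq> E" "complex_vector.independent B" "E \<subseteq> complex_vector.span B"
      "card B = complex_vector.dim E"
    by (rule complex_vector.basis_exists)
  have spanB: "complex_vector.span B = E"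
    using B subspace_E by (metis complex_vector.span_minimal subset_antisym)
  have "complex_vector.independent (blinfun_apply P ` B)"
    using vp.linear_independent_injective_image[OF linear.linear_axioms B(2)] inj_on_E spanB by simp
  moreover have "complex_vector.span (blinfun_apply P ` B) = range (blinfun_apply P)"
    using spanB image_E by (simp add: linear.span_image)
  moreover have "card (blinfun_apply P ` B) = card B"
    using inj_on_subset[OF inj_on_E B(1)] by (rule card_image)
  ultimately show "complex_vector.dim (range (blinfun_apply P)) = complex_vector.dim E"
    using complex_vector.dim_eq_card_independent complex_vector.dim_span B(4) by metis
qed

end

section \<open>Perturbation of the spectral cluster\<close>

locale reduced_operator = close_projections P Q E
  for P Q :: "'h::complex_hilbert_space \<Rightarrow>\<^sub>L 'h" and E +
  fixes T :: "'h \<Rightarrow>\<^sub>L 'h"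
  assumes linT: "complex_linear T"
    and comm: "\<And>x. blinfun_apply P (blinfun_apply T x) = blinfun_apply T (blinfun_apply P x)"
begin

lemma M_eq: "x \<in> E \<Longrightarrow> M_map T P E x = lift (blinfun_apply T x)"
  by (simp add: M_map_def lift_def U_apply comm)

lemma T_U_eq:
  assumes "r \<in> E" "M_map T P E r = \<nu> *\<^sub>C r"
  shows "blinfun_apply T (U_map P E r) = \<nu> *\<^sub>C U_map P E r"
proof -
  have "T (P r) = P (M_map T P E r)"
    by (simp add: M_eq[OF assms(1)] P_lift comm)
  then show ?thesis
    using assms by (simp add: U_apply complex_linearD[OF linP])
qed

lemma cinner_adjoint_M:
  assumes "z \<in> E"
  shows "cinner (hilbert_adjoint E (M_map T P E) l) z = cinner l (M_map T P E z)"
proof (rule hilbert_adjoint_on(2)[OF closed_E subspace_E _ _ _ assms])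
  show "M_map T P E (x + y) = M_map T P E x + M_map T P E y" if "x \<in> E" "y \<in> E" for x y
    using that complex_vector.subspace_add[OF subspace_E]
    by (simp add: M_eq blinfun.add_right lift_add)
  show "M_map T P E (c *\<^sub>C x) = c *\<^sub>C M_map T P E x" if "x \<in> E" for c x
    using that complex_vector.subspace_scale[OF subspace_E]
    by (simp add: M_eq complex_linearD[OF linT] lift_scaleC)
  show "norm (M_map T P E x) \<le> ((2 * norm Q + 1) * norm T) * norm x" if "x \<in> E" for x
  proof -
    have "norm (lift (T x)) \<le> (2 * norm Q + 1) * norm (T x)" by (rule norm_lift_le)
    also have "\<dots> \<le> (2 * norm Q + 1) * (norm T * norm x)"
      by (intro mult_left_mono norm_blinfun) simp
    finally show ?thesis using that by (simp add: M_eq mult.assoc)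
  qed
qed

lemma adjoint_T_V_eq:
  assumes l: "hilbert_adjoint E (M_map T P E) l = cnj \<nu> *\<^sub>C l"
  shows "hilbert_adjoint UNIV (blinfun_apply T) (V_map P E l) = cnj \<nu> *\<^sub>C V_map P E l"
proof (rule hilbert_adjoint_eqI)
  fix z
  have "lift (T z) = M_map T P E (lift z)"
    unfolding M_eq[OF lift_in_E] by (intro lift_unique lift_in_E) (simp add: P_lift comm)
  then show "cinner (cnj \<nu> *\<^sub>C V_map P E l) z = cinner (V_map P E l) (T z)"
    using cinner_adjoint_M[OF lift_in_E, of l z] l
    by (simp add: cinner_scaleC_left cinner_V)
qed (auto simp: complex_vector.subspace_UNIV)

lemma cinner_V_U: "r \<in> E \<Longrightarrow> cinner (V_map P E l) (U_map P E r) = cinner l r"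
  by (simp add: cinner_V U_apply lift_unique idemP)

text \<open>On \<open>E\<close> the difference is \<open>lift z - Q z = (Q - P) (lift z - z)\<close> at \<open>z = T x\<close>.  The second factor is small
  too, because \<open>lift z\<close> is close to \<open>Q z\<close> and \<open>T\<close> is close to an operator \<open>A\<close> that maps \<open>E\<close> into itself.\<close>

lemma norm_M_minus_QT_le:
  assumes x: "x \<in> E" and inv: "\<And>x. x \<in> E \<Longrightarrow> blinfun_apply A x \<in> E"
  shows "norm (M_map T P E x - blinfun_apply Q (blinfun_apply T x))
    \<le> norm (P - Q) * (norm (P - Q) * ((2 * norm Q + 2) * norm T) + (norm Q + 1) * norm (T - A)) * norm x"
proof -
  let ?d = "norm (P - Q)" and ?z = "blinfun_apply T x" and ?w = "blinfun_apply (T - A) x"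
  have "Q ?z - ?z = Q ?w - ?w"
    using inv[OF x] by (simp add: in_E_iff blinfun.diff_left blinfun.diff_right)
  then have "norm (Q ?z - ?z) \<le> norm Q * norm ?w + norm ?w"
    using norm_triangle_ineq4[of "Q ?w" ?w] norm_blinfun[of Q ?w] by simp
  also have "\<dots> = (norm Q + 1) * norm ?w" by (simp add: algebra_simps)
  also have "\<dots> \<le> (norm Q + 1) * (norm (T - A) * norm x)"
    by (intro mult_left_mono norm_blinfun) simp
  finally have 1: "norm (Q ?z - ?z) \<le> (norm Q + 1) * (norm (T - A) * norm x)" .
  have "norm (lift ?z - Q ?z) \<le> ?d * ((2 * norm Q + 2) * norm ?z)"
    by (rule norm_lift_minus_Q_le)
  also have "\<dots> \<le> ?d * ((2 * norm Q + 2) * (norm T * norm x))"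
    by (intro mult_left_mono norm_blinfun) auto
  finally have 2: "norm (lift ?z - Q ?z) \<le> ?d * ((2 * norm Q + 2) * (norm T * norm x))" .
  have "norm (lift ?z - ?z) \<le> norm (lift ?z - Q ?z) + norm (Q ?z - ?z)"
    using norm_triangle_ineq[of "lift ?z - Q ?z" "Q ?z - ?z"] by simp
  then have "norm (lift ?z - ?z)
      \<le> (?d * ((2 * norm Q + 2) * norm T) + (norm Q + 1) * norm (T - A)) * norm x"
    using 1 2 by (simp add: algebra_simps)
  then have "?d * norm (lift ?z - ?z)
      \<le> ?d * ((?d * ((2 * norm Q + 2) * norm T) + (norm Q + 1) * norm (T - A)) * norm x)"
    by (intro mult_left_mono) auto
  then show ?thesis
    using lift_minus_Q_le[of ?z] M_eq[OF x] by (simp add: mult.assoc)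
qed

end

lemma opnorm_on_le:
  fixes X :: "'h::complex_hilbert_space set"
  assumes "complex_vector.subspace X" "0 \<le> c" "\<And>x. x \<in> X \<Longrightarrow> norm (A x) \<le> c * norm x"
  shows "opnorm_on X A \<le> c"
  unfolding opnorm_on_def
proof (rule cSUP_least)
  show "{x \<in> X. norm x \<le> 1} \<noteq> {}"
    using complex_vector.subspace_0[OF assms(1)] by auto
  fix x assume x: "x \<in> {x \<in> X. norm x \<le> 1}"
  then have "c * norm x \<le> c * 1"
    using \<open>0 \<le> c\<close> by (intro mult_left_mono) auto
  then show "norm (A x) \<le> c" using assms(3)[of x] x by simp
qed

text \<open>The perturbation theorem for one operator \<open>T\<close>.  Its constants come from the Lipschitz estimate for
  Riesz projections; that \<open>T\<close> has spectrum inside the contour follows from the rank of its projection.\<close>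

theorem riesz_cluster_perturbation:
  fixes Tref Pref :: "'h::complex_hilbert_space \<Rightarrow>\<^sub>L 'h"
  assumes lin: "complex_linear Tref"
    and pos: "positive_contour \<gamma>"
    and cluster: "encloses_cluster \<gamma> Tref"
    and Pref: "Pref = riesz_projection \<gamma> Tref"
    and E: "E = range (blinfun_apply Pref)"
    and fin: "\<exists>S. finite S \<and> complex_vector.span S = E"
    and dim: "1 \<le> complex_vector.dim E"
  obtains \<epsilon>\<^sub>0 C where "\<epsilon>\<^sub>0 > 0"
    "\<And>T P \<epsilon>. \<lbrakk>complex_linear T; norm (T - Tref) \<le> \<epsilon>; \<epsilon> \<le> \<epsilon>\<^sub>0; P = riesz_projection \<gamma> T\<rbrakk> \<Longrightarrow>
       reduced_operator P Pref E T \<and>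
       encloses_cluster \<gamma> T \<and>
       norm (P - Pref) + opnorm_on E (\<lambda>x. U_map P E x - x)
         + opnorm_on E (\<lambda>x. V_map P E x - hilbert_adjoint UNIV (blinfun_apply Pref) x) \<le> C * \<epsilon> \<and>
       opnorm_on E (\<lambda>x. M_map T P E x - blinfun_apply Pref (blinfun_apply T x)) \<le> C * \<epsilon>\<^sup>2 \<and>
       (\<forall>r\<in>E. norm (U_map P E r - r) \<le> C * \<epsilon> * norm r) \<and>
       (\<forall>l. norm (V_map P E l - hilbert_adjoint UNIV (blinfun_apply Pref) l) \<le> C * \<epsilon> * norm l)"
proof -
  have im: "path_image \<gamma> \<subseteq> resolvent_set Tref"
    using cluster by (simp add: encloses_cluster_def)
  have \<gamma>: "valid_path \<gamma>" using pos by (simp add: positive_contour_def)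
  obtain e L where e: "e > 0" and L: "L > 0"
    and im_T: "\<And>T. complex_linear T \<Longrightarrow> norm (T - Tref) \<le> e \<Longrightarrow> path_image \<gamma> \<subseteq> resolvent_set T"
    and lip: "\<And>T. complex_linear T \<Longrightarrow> norm (T - Tref) \<le> e \<Longrightarrow>
      norm (riesz_projection \<gamma> T - Pref) \<le> L * norm (T - Tref)"
    using riesz_projection_perturbation[OF lin \<gamma> im] unfolding Pref by metis
  obtain p where "contour_projection Tref Pref p"
    using contour_projection_riesz[OF lin pos im] Pref by metis
  then interpret ref: contour_projection Tref Pref p .
  define q where "q = norm Pref"
  define \<epsilon>\<^sub>0 where "\<epsilon>\<^sub>0 = min e (1 / (2 * L))"
  \<comment> \<open>\<open>C1\<close> adds up the three linear bounds.  In the quadratic bound \<open>C2\<close>, \<open>\<parallel>T\<parallel>\<close> is estimated by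
    \<open>\<parallel>T_ref\<parallel> + \<epsilon>\<^sub>0\<close>.\<close>
  define C1 where "C1 = L * (2 * q + 4)"
  define C2 where "C2 = L * (L * ((2 * q + 2) * (norm Tref + \<epsilon>\<^sub>0)) + (q + 1))"
  have q: "q \<ge> 0" by (simp add: q_def)
  have \<epsilon>\<^sub>0: "\<epsilon>\<^sub>0 > 0" using e L q by (simp add: \<epsilon>\<^sub>0_def)
  have C: "C1 \<ge> 0" "C2 \<ge> 0"
    using L q \<epsilon>\<^sub>0 by (auto simp: C1_def C2_def intro!: mult_nonneg_nonneg add_nonneg_nonneg)
  show thesis
  proof (rule that[OF \<epsilon>\<^sub>0, of "C1 + C2"])
    fix T P :: "'h \<Rightarrow>\<^sub>L 'h" and \<epsilon>
    assume linT: "complex_linear T" and T: "norm (T - Tref) \<le> \<epsilon>" and small: "\<epsilon> \<le> \<epsilon>\<^sub>0"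
      and P: "P = riesz_projection \<gamma> T"
    have \<epsilon>: "\<epsilon> \<ge> 0" using T norm_ge_zero order_trans by blast
    have Te: "norm (T - Tref) \<le> e" using T small by (simp add: \<epsilon>\<^sub>0_def)
    have imT: "path_image \<gamma> \<subseteq> resolvent_set T" by (rule im_T[OF linT Te])
    obtain p' where "contour_projection T P p'"
      using contour_projection_riesz[OF linT pos imT] P by metis
    then interpret T: contour_projection T P p' .
    have \<delta>: "norm (P - Pref) \<le> L * \<epsilon>"
      using lip[OF linT Te] mult_left_mono[OF T less_imp_le[OF L]] unfolding P by linarith
    have "\<epsilon> \<le> 1 / (2 * L)" using small by (simp add: \<epsilon>\<^sub>0_def)
    moreover have "0 < 2 * L" using L by simp
    ultimately have "\<epsilon> * (2 * L) \<le> 1" by (simp only: pos_le_divide_eq)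
    then have half: "L * \<epsilon> \<le> 1 / 2" by (simp add: algebra_simps)
    interpret reduced_operator P Pref E T
    proof
      show "norm (P - Pref) \<le> 1 / 2"
        using \<delta> half by linarith
    qed (fact T.complex_linear_P ref.complex_linear_P T.P_idempotent ref.P_idempotent E linT T.P_commute_A)+
    have "complex_vector.dim (range (blinfun_apply P)) = complex_vector.dim E"
      using range_P_finite_dim(2) fin by blast
    moreover have "complex_vector.dim {0::'h} = 0"
      using complex_vector.dim_span[of "{} :: 'h set"] complex_vector.dim_eq_card_independent[of "{} :: 'h set"]
      by (simp add: complex_vector.independent_empty)
    ultimately have "range (blinfun_apply P) \<noteq> {0}" using dim by auto
    then have "P \<noteq> 0" by auto
    then have encl: "encloses_cluster \<gamma> T"
      using encloses_cluster_if_riesz_projection_nonzero[OF linT pos imT] P by simp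
    have U: "norm (U_map P E r - r) \<le> L * \<epsilon> * norm r" if "r \<in> E" for r
    proof -
      have "norm (P r - Pref r) \<le> L * \<epsilon> * norm r"
        using norm_diff_apply[of r] mult_right_mono[OF \<delta> norm_ge_zero[of r]] by linarith
      then show ?thesis using that by (simp add: U_apply in_E_iff)
    qed
    have V: "norm (V_map P E l - hilbert_adjoint UNIV (blinfun_apply Pref) l) \<le> L * \<epsilon> * (2 * q + 2) * norm l" for l
    proof -
      have "norm (P - Pref) * (2 * q + 2) * norm l \<le> L * \<epsilon> * (2 * q + 2) * norm l"
        using q by (intro mult_right_mono \<delta>) auto
      then show ?thesis using norm_V_minus_adjoint_le[of l] unfolding q_def by linarith
    qed
    have L\<epsilon>: "0 \<le> L * \<epsilon>" using L \<epsilon> by simp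
    have opU: "opnorm_on E (\<lambda>x. U_map P E x - x) \<le> L * \<epsilon>"
      by (rule opnorm_on_le[OF subspace_E L\<epsilon> U])
    have opV: "opnorm_on E (\<lambda>x. V_map P E x - hilbert_adjoint UNIV (blinfun_apply Pref) x) \<le> L * \<epsilon> * (2 * q + 2)"
      using L\<epsilon> q by (intro opnorm_on_le[OF subspace_E] V) auto
    have C1: "C1 * \<epsilon> \<le> (C1 + C2) * \<epsilon>" and C2: "C2 * \<epsilon>\<^sup>2 \<le> (C1 + C2) * \<epsilon>\<^sup>2"
      using C \<epsilon> by (auto intro!: mult_right_mono)
    have sum: "norm (P - Pref) + opnorm_on E (\<lambda>x. U_map P E x - x)
         + opnorm_on E (\<lambda>x. V_map P E x - hilbert_adjoint UNIV (blinfun_apply Pref) x) \<le> C1 * \<epsilon>"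
      using \<delta> opU opV by (simp add: C1_def algebra_simps)
    have "norm T \<le> norm Tref + \<epsilon>\<^sub>0"
      using norm_triangle_ineq2[of T Tref] T small by linarith
    have inv: "blinfun_apply Tref x \<in> E" if "x \<in> E" for x
      using that by (simp add: in_E_iff ref.P_commute_A)
    have M: "norm (M_map T P E x - Pref (T x)) \<le> C2 * \<epsilon>\<^sup>2 * norm x" if "x \<in> E" for x
    proof -
      have "norm (P - Pref) * ((2 * q + 2) * norm T) \<le> (L * \<epsilon>) * ((2 * q + 2) * (norm Tref + \<epsilon>\<^sub>0))"
        using \<delta> \<open>norm T \<le> norm Tref + \<epsilon>\<^sub>0\<close> q L\<epsilon> by (intro mult_mono) auto
      moreover have "(q + 1) * norm (T - Tref) \<le> (q + 1) * \<epsilon>"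
        using T q by (intro mult_left_mono) auto
      ultimately have "norm (P - Pref) * ((2 * q + 2) * norm T) + (q + 1) * norm (T - Tref)
          \<le> (L * ((2 * q + 2) * (norm Tref + \<epsilon>\<^sub>0)) + (q + 1)) * \<epsilon>"
        by (simp add: algebra_simps)
      then have "norm (P - Pref) * (norm (P - Pref) * ((2 * q + 2) * norm T) + (q + 1) * norm (T - Tref))
          \<le> (L * \<epsilon>) * ((L * ((2 * q + 2) * (norm Tref + \<epsilon>\<^sub>0)) + (q + 1)) * \<epsilon>)"
        using \<delta> q L\<epsilon> by (intro mult_mono) auto
      also have "\<dots> = C2 * \<epsilon>\<^sup>2"
        by (simp add: C2_def power2_eq_square)
      finally have "norm (P - Pref) * (norm (P - Pref) * ((2 * q + 2) * norm T) + (q + 1) * norm (T - Tref)) * norm x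
          \<le> C2 * \<epsilon>\<^sup>2 * norm x"
        by (intro mult_right_mono) auto
      then show ?thesis
        using norm_M_minus_QT_le[OF that inv] unfolding q_def by linarith
    qed
    have opM: "opnorm_on E (\<lambda>x. M_map T P E x - Pref (T x)) \<le> C2 * \<epsilon>\<^sup>2"
      using C by (intro opnorm_on_le[OF subspace_E] M) auto
    have weak: "a * norm r \<le> (C1 + C2) * \<epsilon> * norm r" if "a \<le> C1 * \<epsilon>" for a and r :: 'h
      using that C1 by (intro mult_right_mono) auto
    have "L * \<epsilon> \<le> C1 * \<epsilon>" "L * \<epsilon> * (2 * q + 2) \<le> C1 * \<epsilon>"
      using L\<epsilon> q mult_nonneg_nonneg[OF L\<epsilon> q] by (simp_all add: C1_def algebra_simps)
    note UV = this[THEN weak]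
    show "reduced_operator P Pref E T \<and>
       encloses_cluster \<gamma> T \<and>
       norm (P - Pref) + opnorm_on E (\<lambda>x. U_map P E x - x)
         + opnorm_on E (\<lambda>x. V_map P E x - hilbert_adjoint UNIV (blinfun_apply Pref) x) \<le> (C1 + C2) * \<epsilon> \<and>
       opnorm_on E (\<lambda>x. M_map T P E x - blinfun_apply Pref (blinfun_apply T x)) \<le> (C1 + C2) * \<epsilon>\<^sup>2 \<and>
       (\<forall>r\<in>E. norm (U_map P E r - r) \<le> (C1 + C2) * \<epsilon> * norm r) \<and>
       (\<forall>l. norm (V_map P E l - hilbert_adjoint UNIV (blinfun_apply Pref) l) \<le> (C1 + C2) * \<epsilon> * norm l)"
      using reduced_operator_axioms encl order_trans[OF sum C1] order_trans[OF opM C2]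
        order_trans[OF U UV(1)] order_trans[OF V UV(2)] by blast
  qed
qed

section \<open>The weighted symbol\<close>

text \<open>As \<open>q\<close> is onto, at most one operator is induced, so the description picks out a complex-linear one.\<close>

lemma complex_linear_boundary_operator:
  assumes H: "H_model \<Omega> k q"
  shows "complex_linear (boundary_operator \<Omega> k q \<eta> lam n)"
proof (cases "\<exists>B. induces \<Omega> k q (boundary_map \<Omega> k \<eta> lam n) B")
  case True
  have "B = B'" if "induces \<Omega> k q (boundary_map \<Omega> k \<eta> lam n) B"
    "induces \<Omega> k q (boundary_map \<Omega> k \<eta> lam n) B'" for B B'
  proof (rule blinfun_eqI)
    fix x
    obtain \<phi> where "\<phi> \<in> H_functions \<Omega> k" "x = q \<phi>"
      using H unfolding H_model_def by blast
    then show "blinfun_apply B x = blinfun_apply B' x"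
      using that by (simp add: induces_def)
  qed
  with True have "\<exists>!B. induces \<Omega> k q (boundary_map \<Omega> k \<eta> lam n) B" by blast
  then have "induces \<Omega> k q (boundary_map \<Omega> k \<eta> lam n) (boundary_operator \<Omega> k q \<eta> lam n)"
    using True by (simp add: boundary_operator_def theI')
  then show ?thesis by (simp add: induces_def)
next
  case False
  then show ?thesis by (simp add: boundary_operator_def complex_linear_def)
qed

text \<open>The default value \<open>0\<close> of a divergent sum is complex-linear as well.\<close>

lemma complex_linear_infsum:
  fixes f :: "'i \<Rightarrow> 'h::complex_hilbert_space \<Rightarrow>\<^sub>L 'h"
  assumes "\<And>n. complex_linear (f n)"
  shows "complex_linear (infsum f UNIV)"
proof (cases "f summable_on UNIV")
  case True
  show ?thesis
    unfolding complex_linear_def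
  proof (intro allI)
    fix c x
    let ?h = "\<lambda>A :: 'h \<Rightarrow>\<^sub>L 'h. A (c *\<^sub>C x) - c *\<^sub>C A x"
    have "bounded_linear ?h"
      by (intro bounded_linear_sub bounded_linear_compose[OF bounded_linear_scaleC]
          bounded_linear_apply_blinfun)
    then have "((\<lambda>n. ?h (f n)) has_sum ?h (infsum f UNIV)) UNIV"
      using True has_sum_bounded_linear has_sum_infsum by blast
    moreover have "((\<lambda>n. ?h (f n)) has_sum 0) UNIV"
      using assms by (simp add: complex_linear_def)
    ultimately show "infsum f UNIV (c *\<^sub>C x) = c *\<^sub>C infsum f UNIV x"
      using has_sum_unique by fastforce
  qed
qed (simp add: infsum_not_exists complex_linear_def)

lemma complex_linear_weighted_symbol:
  assumes "H_model \<Omega> k q"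
  shows "complex_linear (weighted_symbol \<Omega> k q \<eta> lam \<beta> t)"
  unfolding weighted_symbol_def
  by (intro complex_linear_infsum complex_linear_scale_op complex_linear_boundary_operator assms)

lemma summable_on_imp_bounded_sums:
  fixes f :: "'i \<Rightarrow> 'a::real_normed_vector"
  assumes "f summable_on UNIV"
  obtains M where "\<And>F. finite F \<Longrightarrow> norm (sum f F) \<le> M"
proof -
  obtain L where "(f has_sum L) UNIV" using assms by (auto simp: summable_on_def)
  then have "\<forall>\<^sub>F F in finite_subsets_at_top UNIV. dist (sum f F) L < 1"
    unfolding has_sum_def by (rule tendstoD) simp
  then obtain F0 where F0: "finite F0" "\<And>F. finite F \<Longrightarrow> F0 \<subseteq> F \<Longrightarrow> dist (sum f F) L < 1"
    unfolding eventually_finite_subsets_at_top by auto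
  have "norm (sum f F) \<le> norm L + 1 + (\<Sum>i\<in>F0. norm (f i))" if "finite F" for F
  proof -
    have "sum f (F \<union> F0) = sum f F + sum f (F0 - F)"
      using that F0(1) sum.union_disjoint[of F "F0 - F" f] by (simp add: Un_Diff_cancel)
    then have "norm (sum f F) \<le> norm (sum f (F \<union> F0)) + norm (sum f (F0 - F))"
      by (metis add_diff_cancel norm_triangle_ineq4)
    also have "norm (sum f (F \<union> F0)) \<le> norm L + 1"
      using F0(2)[of "F \<union> F0"] that F0(1) norm_triangle_ineq2[of "sum f (F \<union> F0)" L]
      by (simp add: dist_norm)
    also have "norm (sum f (F0 - F)) \<le> (\<Sum>i\<in>F0 - F. norm (f i))"
      by (rule norm_sum)
    also have "\<dots> \<le> (\<Sum>i\<in>F0. norm (f i))"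
      using F0(1) by (intro sum_mono2) auto
    finally show ?thesis by simp
  qed
  then show thesis by (rule that)
qed

text \<open>Multipliers in \<open>[0, 1]\<close> produce convex combinations of subset sums.\<close>

lemma norm_unit_multiplier_sum_le:
  fixes f :: "'i \<Rightarrow> 'a::real_normed_vector"
  assumes "finite F" and c: "\<And>i. 0 \<le> c i \<and> c i \<le> (1::real)"
    and "\<And>S. S \<subseteq> F \<Longrightarrow> norm (b + sum f S) \<le> M"
  shows "norm (b + (\<Sum>i\<in>F. c i *\<^sub>R f i)) \<le> M"
  using assms(1,3)
proof (induction F arbitrary: b)
  case empty
  from empty[of "{}"] show ?case by simp
next
  case (insert a F)
  let ?s = "\<Sum>i\<in>F. c i *\<^sub>R f i"
  have 1: "norm (b + ?s) \<le> M"
    using insert.prems by (intro insert.IH) blast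
  have 2: "norm ((b + f a) + ?s) \<le> M"
  proof (rule insert.IH)
    fix S assume S: "S \<subseteq> F"
    then have "sum f (insert a S) = f a + sum f S"
      using insert.hyps finite_subset[OF S] by (intro sum.insert) auto
    moreover have "norm (b + sum f (insert a S)) \<le> M"
      using S by (intro insert.prems) auto
    ultimately show "norm ((b + f a) + sum f S) \<le> M" by (simp add: add.assoc)
  qed
  have "b + (\<Sum>i\<in>insert a F. c i *\<^sub>R f i) = (1 - c a) *\<^sub>R (b + ?s) + c a *\<^sub>R ((b + f a) + ?s)"
    using insert.hyps by (simp add: algebra_simps)
  also have "norm \<dots> \<le> (1 - c a) * norm (b + ?s) + c a * norm ((b + f a) + ?s)"
    using c[of a] by (intro norm_triangle_le) simp
  also have "\<dots> \<le> (1 - c a) * M + c a * M"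
    using c[of a] 1 2 by (intro add_mono mult_left_mono) auto
  finally show ?case by (simp add: algebra_simps)
qed

text \<open>The factor 4 counts the positive and negative parts of the real and the imaginary part.\<close>

lemma norm_phase_multiplier_sum_le:
  fixes f :: "'i \<Rightarrow> 'h::complex_hilbert_space \<Rightarrow>\<^sub>L 'h"
  assumes F: "finite F" and c: "\<And>i. cmod (c i) \<le> 1"
    and M: "\<And>S. finite S \<Longrightarrow> norm (sum f S) \<le> M"
  shows "norm (\<Sum>i\<in>F. scale_op (c i) (f i)) \<le> 4 * M"
proof -
  have unit: "norm (\<Sum>i\<in>F. d i *\<^sub>R f i) \<le> M" if "\<And>i. 0 \<le> d i \<and> d i \<le> 1" for d
  proof -
    have "norm (0 + sum f S) \<le> M" if "S \<subseteq> F" for S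
      using M[OF finite_subset[OF that F]] by simp
    from norm_unit_multiplier_sum_le[of F d 0 f M, OF F that this] show ?thesis by simp
  qed
  have signed: "norm (\<Sum>i\<in>F. d i *\<^sub>R f i) \<le> 2 * M" if d: "\<And>i. \<bar>d i\<bar> \<le> 1" for d
  proof -
    have "0 \<le> max 0 (d i) \<and> max 0 (d i) \<le> 1" "0 \<le> max 0 (- d i) \<and> max 0 (- d i) \<le> 1" for i
      using d[of i] by auto
    then have "norm (\<Sum>i\<in>F. max 0 (d i) *\<^sub>R f i) \<le> M" "norm (\<Sum>i\<in>F. max 0 (- d i) *\<^sub>R f i) \<le> M"
      by (simp_all only: unit)
    moreover have "d i *\<^sub>R f i = max 0 (d i) *\<^sub>R f i - max 0 (- d i) *\<^sub>R f i" for i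
      by (auto simp: max_def)
    then have "(\<Sum>i\<in>F. d i *\<^sub>R f i) = (\<Sum>i\<in>F. max 0 (d i) *\<^sub>R f i) - (\<Sum>i\<in>F. max 0 (- d i) *\<^sub>R f i)"
      by (simp add: sum_subtractf)
    ultimately show ?thesis
      using norm_triangle_ineq4[of "\<Sum>i\<in>F. max 0 (d i) *\<^sub>R f i" "\<Sum>i\<in>F. max 0 (- d i) *\<^sub>R f i"] by simp
  qed
  have "\<bar>Re (c i)\<bar> \<le> 1" "\<bar>Im (c i)\<bar> \<le> 1" for i
    using c[of i] abs_Re_le_cmod[of "c i"] abs_Im_le_cmod[of "c i"] by linarith+
  note re = signed[of "\<lambda>i. Re (c i)", OF this(1)] and im = signed[of "\<lambda>i. Im (c i)", OF this(2)]
  have "scale_op (of_real a + \<i> * of_real b) A = a *\<^sub>R A + scale_op \<i> (b *\<^sub>R A)"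
    for a b and A :: "'h \<Rightarrow>\<^sub>L 'h"
    by (rule blinfun_eqI)
      (simp add: blinfun.add_left blinfun.scaleR_left scaleC_add_left scaleC_scaleC
        flip: scaleC_complex_of_real)
  from this[of "Re (c i)" "Im (c i)" "f i" for i]
  have "scale_op (c i) (f i) = Re (c i) *\<^sub>R f i + scale_op \<i> (Im (c i) *\<^sub>R f i)" for i
    unfolding complex_eq[symmetric] .
  then have "(\<Sum>i\<in>F. scale_op (c i) (f i))
      = (\<Sum>i\<in>F. Re (c i) *\<^sub>R f i) + scale_op \<i> (\<Sum>i\<in>F. Im (c i) *\<^sub>R f i)"
    by (simp add: sum.distrib scale_op.sum_right)
  moreover have "norm (scale_op \<i> (\<Sum>i\<in>F. Im (c i) *\<^sub>R f i)) \<le> norm (\<Sum>i\<in>F. Im (c i) *\<^sub>R f i)"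
    using norm_scale_op_le[of \<i>] by simp
  ultimately show ?thesis
    using re im norm_triangle_ineq[of "\<Sum>i\<in>F. Re (c i) *\<^sub>R f i" "scale_op \<i> (\<Sum>i\<in>F. Im (c i) *\<^sub>R f i)"]
    by simp
qed

lemma norm_infsum_le_if_bounded_sums:
  fixes f :: "'i \<Rightarrow> 'a::real_normed_vector"
  assumes M: "\<And>F. finite F \<Longrightarrow> norm (sum f F) \<le> M"
  shows "norm (infsum f UNIV) \<le> M"
proof (cases "f summable_on UNIV")
  case True
  then have "(sum f \<longlongrightarrow> infsum f UNIV) (finite_subsets_at_top UNIV)"
    using has_sum_infsum has_sum_def by blast
  then show ?thesis
    by (rule Lim_norm_ubound[rotated]) (use M in \<open>auto intro: eventually_finite_subsets_at_top_weakI\<close>)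
next
  case False
  then show ?thesis
    using M[of "{}"] by (simp add: infsum_not_exists)
qed

text \<open>The terms of the symbol at two values of \<open>t\<close> differ by phases, so unconditional convergence at one
  value bounds the partial sums at every value.  If the series converges nowhere, the symbol is \<open>0\<close>.\<close>

lemma weighted_symbol_bounded:
  obtains M where "\<And>t. norm (weighted_symbol \<Omega> k q \<eta> lam \<beta> t) \<le> M"
proof -
  define f where "f t n = scale_op (exp (- \<i> * of_int n * of_real t) * of_real (lam powr (\<beta> * of_int n)))
    (boundary_operator \<Omega> k q \<eta> lam n)" for t :: real and n :: int
  have T: "weighted_symbol \<Omega> k q \<eta> lam \<beta> t = infsum (f t) UNIV" for t
    by (simp add: weighted_symbol_def f_def[abs_def])
  show thesis
  proof (cases "\<exists>s. f s summable_on UNIV")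
    case True
    then obtain s M where M: "\<And>F. finite F \<Longrightarrow> norm (sum (f s) F) \<le> M"
      using summable_on_imp_bounded_sums by metis
    have split: "exp (- \<i> * of_int n * of_real t)
        = exp (\<i> * of_real (real_of_int n * (s - t))) * exp (- \<i> * of_int n * of_real s)" for t n
      unfolding exp_add[symmetric] by (rule arg_cong[of _ _ exp]) (simp add: algebra_simps)
    have phase: "f t n = scale_op (exp (\<i> * of_real (real_of_int n * (s - t)))) (f s n)" for t n
      unfolding f_def by (subst split) (simp only: scale_op_scale_op mult.assoc)
    have "norm (infsum (f t) UNIV) \<le> 4 * M" for t
    proof (rule norm_infsum_le_if_bounded_sums)
      fix F :: "int set" assume "finite F"
      then show "norm (sum (f t) F) \<le> 4 * M"
        unfolding phase[of t] by (intro norm_phase_multiplier_sum_le M) (simp_all add: norm_exp_i_times)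
    qed
    then show thesis using that T by metis
  next
    case False
    then show thesis using that[of 0] by (simp add: T infsum_not_exists)
  qed
qed

lemma weighted_symbol_periodic:
  obtains s where "s \<in> {0..2 * pi}" "weighted_symbol \<Omega> k q \<eta> lam \<beta> t = weighted_symbol \<Omega> k q \<eta> lam \<beta> s"
proof -
  define m where "m = \<lfloor>t / (2 * pi)\<rfloor>"
  define s where "s = t - 2 * pi * of_int m"
  have "of_int m \<le> t / (2 * pi)" "t / (2 * pi) < of_int m + 1"
    unfolding m_def by linarith+
  then have "s \<in> {0..2 * pi}"
    by (simp add: s_def field_simps)
  moreover have "exp (- \<i> * of_int n * of_real t) = exp (- \<i> * of_int n * of_real s)" for n :: int
  proof -
    have "- \<i> * of_int n * of_real s = - \<i> * of_int n * of_real t + \<i> * (of_int (n * m) * (of_real pi * 2))"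
      by (simp add: s_def algebra_simps)
    then show ?thesis by (simp only: exp_plus_2pin)
  qed
  then have "weighted_symbol \<Omega> k q \<eta> lam \<beta> t = weighted_symbol \<Omega> k q \<eta> lam \<beta> s"
    by (simp only: weighted_symbol_def)
  ultimately show thesis by (rule that)
qed

lemma norm_weighted_symbol_diff_le_Sup:
  "norm (weighted_symbol \<Omega> k q \<eta> lam \<beta> t - A)
    \<le> (SUP s\<in>{0..2 * pi}. norm (weighted_symbol \<Omega> k q \<eta> lam \<beta> s - A))"
proof -
  let ?T = "weighted_symbol \<Omega> k q \<eta> lam \<beta>"
  obtain s where s: "s \<in> {0..2 * pi}" "?T t = ?T s"
    using weighted_symbol_periodic by metis
  obtain M where M: "\<And>t. norm (?T t) \<le> M"
    using weighted_symbol_bounded by metis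
  have "norm (?T r - A) \<le> M + norm A" for r
    using norm_triangle_ineq4[of "?T r" A] M[of r] by linarith
  then have "bdd_above ((\<lambda>r. norm (?T r - A)) ` {0..2 * pi})"
    by (intro bdd_aboveI2)
  then show ?thesis
    using s by (auto intro: cSUP_upper)
qed

theorem proposition4p2:
  fixes Tref Pref :: "'h::complex_hilbert_space \<Rightarrow>\<^sub>L 'h"
    and \<gamma> :: "real \<Rightarrow> complex"
    and E :: "'h set"
  assumes "complex_linear Tref"
    and "positive_contour \<gamma>"
    and "encloses_cluster \<gamma> Tref"
    and "Pref = riesz_projection \<gamma> Tref"
    and "E = range (blinfun_apply Pref)"
    and "\<exists>S. finite S \<and> complex_vector.span S = E"
    and "1 \<le> complex_vector.dim E"
  shows "\<exists>\<epsilon>\<^sub>0 > 0. \<exists>C::real.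
    \<forall>(\<Omega> :: (real^3) set) (r_minus::real) (r_plus::real) (k::real) (\<eta>::real) (lam::real) (\<beta>::real)
     (q :: (real^3 \<Rightarrow> complex) \<Rightarrow> 'h).
      k > 0 \<and> \<eta> > 0 \<and> lam > 1 \<and> -1 < \<beta> \<and> \<beta> < 0 \<and>
      0 < r_minus \<and> r_minus < r_plus \<and> r_plus < lam * r_minus \<and>
      smooth_domain \<Omega> \<and> frontier \<Omega> \<subseteq> {x. r_minus \<le> norm x \<and> norm x \<le> r_plus} \<and>
      H_model \<Omega> k q \<longrightarrow>
      (let T = weighted_symbol \<Omega> k q \<eta> lam \<beta>;
           \<epsilon> = (SUP t\<in>{0..2*pi}. norm (T t - Tref));
           P = (\<lambda>t. riesz_projection \<gamma> (T t));
           U = (\<lambda>t. U_map (P t) E);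
           V = (\<lambda>t. V_map (P t) E);
           M = (\<lambda>t. M_map (T t) (P t) E);
           Pref_adj = hilbert_adjoint UNIV (blinfun_apply Pref)
       in \<epsilon> \<le> \<epsilon>\<^sub>0 \<longrightarrow>
          (\<forall>t.
             encloses_cluster \<gamma> (T t) \<and>
             (\<exists>S. finite S \<and> complex_vector.span S = range (blinfun_apply (P t))) \<and>
             complex_vector.dim (range (blinfun_apply (P t))) = complex_vector.dim E \<and>
             bij_betw (U t) E (range (blinfun_apply (P t))) \<and>
             norm (P t - Pref) + opnorm_on E (\<lambda>x. U t x - x) + opnorm_on E (\<lambda>x. V t x - Pref_adj x)
               \<le> C * \<epsilon> \<and>
             opnorm_on E (\<lambda>x. M t x - blinfun_apply Pref (blinfun_apply (T t) x)) \<le> C * \<epsilon>\<^sup>2 \<and>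
             (\<forall>\<nu> r l. r \<in> E \<and> l \<in> E \<and> M t r = \<nu> *\<^sub>C r \<and>
                 hilbert_adjoint E (M t) l = cnj \<nu> *\<^sub>C l \<and> cinner l r = 1 \<longrightarrow>
               blinfun_apply (T t) (U t r) = \<nu> *\<^sub>C U t r \<and>
               hilbert_adjoint UNIV (blinfun_apply (T t)) (V t l) = cnj \<nu> *\<^sub>C V t l \<and>
               cinner (V t l) (U t r) = 1 \<and>
               norm (U t r - r) \<le> C * \<epsilon> * norm r \<and>
               norm (V t l - Pref_adj l) \<le> C * \<epsilon> * norm l)))"
proof -
  obtain \<epsilon>\<^sub>0 C where \<epsilon>\<^sub>0: "\<epsilon>\<^sub>0 > 0"
    and abstract: "\<And>T P \<epsilon>. \<lbrakk>complex_linear T; norm (T - Tref) \<le> \<epsilon>; \<epsilon> \<le> \<epsilon>\<^sub>0; P = riesz_projection \<gamma> T\<rbrakk> \<Longrightarrow>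
       reduced_operator P Pref E T \<and>
       encloses_cluster \<gamma> T \<and>
       norm (P - Pref) + opnorm_on E (\<lambda>x. U_map P E x - x)
         + opnorm_on E (\<lambda>x. V_map P E x - hilbert_adjoint UNIV (blinfun_apply Pref) x) \<le> C * \<epsilon> \<and>
       opnorm_on E (\<lambda>x. M_map T P E x - blinfun_apply Pref (blinfun_apply T x)) \<le> C * \<epsilon>\<^sup>2 \<and>
       (\<forall>r\<in>E. norm (U_map P E r - r) \<le> C * \<epsilon> * norm r) \<and>
       (\<forall>l. norm (V_map P E l - hilbert_adjoint UNIV (blinfun_apply Pref) l) \<le> C * \<epsilon> * norm l)"
    using riesz_cluster_perturbation[OF assms] by blast
  obtain S where S: "finite S" "complex_vector.span S = E"
    using assms(6) by blast
  show ?thesis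
    unfolding Let_def
  proof (rule exI[of _ \<epsilon>\<^sub>0], rule conjI[OF \<epsilon>\<^sub>0], rule exI[of _ C], intro allI impI, goal_cases)
    case (1 \<Omega> r_minus r_plus k \<eta> lam \<beta> q t)
    let ?T = "weighted_symbol \<Omega> k q \<eta> lam \<beta> t" and ?P = "riesz_projection \<gamma> (weighted_symbol \<Omega> k q \<eta> lam \<beta> t)"
    have "complex_linear ?T"
      using 1(1) complex_linear_weighted_symbol by blast
    note facts = abstract[OF this norm_weighted_symbol_diff_le_Sup 1(2) refl]
    interpret reduced_operator ?P Pref E ?T
      using facts by blast
    have "blinfun_apply ?T (U_map ?P E r) = \<nu> *\<^sub>C U_map ?P E r \<and>
        hilbert_adjoint UNIV (blinfun_apply ?T) (V_map ?P E l) = cnj \<nu> *\<^sub>C V_map ?P E l \<and>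
        cinner (V_map ?P E l) (U_map ?P E r) = 1"
      if "r \<in> E" "M_map ?T ?P E r = \<nu> *\<^sub>C r" "hilbert_adjoint E (M_map ?T ?P E) l = cnj \<nu> *\<^sub>C l"
        "cinner l r = 1" for \<nu> r l
      using that T_U_eq adjoint_T_V_eq cinner_V_U by simp
    then show ?case
      using facts range_P_finite_dim[OF S] bij_U by blast
  qed
qed

end
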